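(* Let $\mathfrak{g}$ be a finite-dimensional semisimple Lie algebra over $\mathbb{F}=\mathbb{R}$ or $\mathbb{F}=\mathbb{C}$, and let $\Omega:[\mathfrak{g}^*]^{\odot 2}\to[\mathfrak{g}^*]^{\odot 2}$, $\Lambda:[\mathfrak{g}^*]^{\odot 2}\to[\mathfrak{g}^*]^{\wedge 4}$ and $\Pi:[\mathfrak{g}^*]^{\otimes 4}\to[\mathfrak{g}^*]^{\otimes 2}$ be the operators associated with $\mathfrak{g}$ defined in the context. Let $\Pi\Lambda:[\mathfrak{g}^*]^{\odot 2}\to[\mathfrak{g}^*]^{\odot 2}$ denote the composite of $\Lambda$ with the restriction of $\Pi$ to $[\mathfrak{g}^*]^{\wedge 4}\subset[\mathfrak{g}^*]^{\otimes 4}$. Then $$2\,\Pi\Lambda=-(\Omega+\mathrm{Id})(\Omega-2\,\mathrm{Id}).$$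
   Context: All duals, tensor products and (bi)linear maps are over $\mathbb{F}$. $[\mathfrak{g}^*]^{\odot 2}$ is the space of symmetric $\mathbb{F}$-bilinear forms on $\mathfrak{g}$, $[\mathfrak{g}^*]^{\wedge 4}$ the space of exterior (alternating) 4-forms on $\mathfrak{g}$, viewed as a subspace of the space $[\mathfrak{g}^*]^{\otimes 4}$ of $4$-linear forms, where $(\xi\otimes\xi'\otimes\eta\otimes\eta')(x,x',y,y')=\xi(x)\xi'(x')\eta(y)\eta'(y')$. For $x\in\mathfrak{g}$, $\mathrm{Ad}\,x$ denotes the operator $[x,\cdot\,]:\mathfrak{g}\to\mathfrak{g}$, and $\beta$ is the Killing form, $\beta(x,y)=\mathrm{tr}[(\mathrm{Ad}\,x)(\mathrm{Ad}\,y)]$ (nondegenerate since $\mathfrak{g}$ is semisimple). Operator $\Omega$: for $\sigma\in[\mathfrak{g}^*]^{\odot 2}$, $[\Omega\sigma](x,y)=2\,\mathrm{tr}[(\mathrm{Ad}\,x)(\mathrm{Ad}\,y)\Sigma]$, where $\Sigma:\mathfrak{g}\to\mathfrak{g}$ is the linear operator with $\sigma(x,y)=\beta(\Sigma x,y)$ for all $x,y\in\mathfrak{g}$. Operator $\Lambda$: $(\Lambda\sigma)(x,y,z,z')=\sigma([x,y],[z,z'])+\sigma([y,z],[x,z'])+\sigma([z,x],[y,z'])$. Operator $\Pi$: the linear map with $\Pi(\xi\otimes\xi'\otimes\eta\otimes\eta')=\beta([x,x'],\cdot\,)\otimes\beta([y,y'],\cdot\,)$ for $\xi,\xi',\eta,\eta'\in\mathfrak{g}^*$,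 where $x,x',y,y'\in\mathfrak{g}$ are characterized by $\xi=\beta(x,\cdot\,)$, $\xi'=\beta(x',\cdot\,)$, $\eta=\beta(y,\cdot\,)$, $\eta'=\beta(y',\cdot\,)$. One has $\Pi([\mathfrak{g}^*]^{\wedge 4})\subset[\mathfrak{g}^*]^{\odot 2}$. *)

theory Defs
  imports Complex_Main "HOL-Library.FuncSet"
begin

text \<open>
  Lie algebras over a field \<open>'f\<close>, carried by a whole type \<open>'g\<close>.  A form is a curried
  function into \<open>'f\<close>.  A map defined only on some space of forms is extensional on that
  space: outside of it, its value is \<open>undefined\<close>.
\<close>

locale lie_algebra = vector_space scale
  for scale :: "'f::field \<Rightarrow> 'g::ab_group_add \<Rightarrow> 'g" +
  fixes bracket :: "'g \<Rightarrow> 'g \<Rightarrow> 'g"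
  assumes finite_dim: "\<exists>B. finite B \<and> span B = UNIV"
    and linear_bracket_left: "Vector_Spaces.linear scale scale (\<lambda>x. bracket x y)"
    and linear_bracket_right: "Vector_Spaces.linear scale scale (\<lambda>y. bracket x y)"
    and bracket_self: "bracket x x = 0"
    and jacobi: "bracket x (bracket y z) + bracket y (bracket z x) + bracket z (bracket x y) = 0"
begin

definition ideal :: "'g set \<Rightarrow> bool" where
  "ideal I \<longleftrightarrow> subspace I \<and> (\<forall>x. \<forall>y\<in>I. bracket x y \<in> I)"

primrec derived_series :: "'g set \<Rightarrow> nat \<Rightarrow> 'g set" where
  "derived_series I 0 = I"
| "derived_series I (Suc n) =
     span {bracket x y | x y. x \<in> derived_series I n \<and> y \<in> derived_series I n}"

definition solvable :: "'g set \<Rightarrow> bool" where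
  "solvable I \<longleftrightarrow> (\<exists>n. derived_series I n = {0})"

text \<open>The trace is computed in the basis \<open>extend_basis {}\<close>; by \<open>trace_eq\<close> below, any
  other basis gives the same value.\<close>

definition trace :: "('g \<Rightarrow> 'g) \<Rightarrow> 'f" where
  "trace T = (\<Sum>b\<in>extend_basis {}. representation (extend_basis {}) (T b) b)"

abbreviation Ad :: "'g \<Rightarrow> 'g \<Rightarrow> 'g" where
  "Ad x \<equiv> (\<lambda>y. bracket x y)"

definition killing :: "'g \<Rightarrow> 'g \<Rightarrow> 'f" where
  "killing x y = trace (Ad x \<circ> Ad y)"

definition dual_space :: "('g \<Rightarrow> 'f) set" where
  "dual_space = {\<xi>. Vector_Spaces.linear scale (*) \<xi>}"

definition bilinear_forms :: "('g \<Rightarrow> 'g \<Rightarrow> 'f) set" where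
  "bilinear_forms = {\<sigma>. (\<forall>y. (\<lambda>x. \<sigma> x y) \<in> dual_space) \<and> (\<forall>x. (\<lambda>y. \<sigma> x y) \<in> dual_space)}"

definition symmetric_forms :: "('g \<Rightarrow> 'g \<Rightarrow> 'f) set" where
  "symmetric_forms = {\<sigma> \<in> bilinear_forms. \<forall>x y. \<sigma> x y = \<sigma> y x}"

definition quadrilinear_forms :: "('g \<Rightarrow> 'g \<Rightarrow> 'g \<Rightarrow> 'g \<Rightarrow> 'f) set" where
  "quadrilinear_forms = {\<phi>.
     (\<forall>b c d. (\<lambda>a. \<phi> a b c d) \<in> dual_space) \<and> (\<forall>a c d. (\<lambda>b. \<phi> a b c d) \<in> dual_space) \<and>
     (\<forall>a b d. (\<lambda>c. \<phi> a b c d) \<in> dual_space) \<and> (\<forall>a b c. (\<lambda>d. \<phi> a b c d) \<in> dual_space)}"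

definition exterior_4_forms :: "('g \<Rightarrow> 'g \<Rightarrow> 'g \<Rightarrow> 'g \<Rightarrow> 'f) set" where
  "exterior_4_forms = {\<phi> \<in> quadrilinear_forms. \<forall>a b c d.
     a = b \<or> a = c \<or> a = d \<or> b = c \<or> b = d \<or> c = d \<longrightarrow> \<phi> a b c d = 0}"

definition tensor2 :: "('g \<Rightarrow> 'f) \<Rightarrow> ('g \<Rightarrow> 'f) \<Rightarrow> 'g \<Rightarrow> 'g \<Rightarrow> 'f" where
  "tensor2 \<xi> \<eta> = (\<lambda>u v. \<xi> u * \<eta> v)"

definition tensor4 :: "('g \<Rightarrow> 'f) \<Rightarrow> ('g \<Rightarrow> 'f) \<Rightarrow> ('g \<Rightarrow> 'f) \<Rightarrow> ('g \<Rightarrow> 'f) \<Rightarrow>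
    'g \<Rightarrow> 'g \<Rightarrow> 'g \<Rightarrow> 'g \<Rightarrow> 'f" where
  "tensor4 \<xi> \<xi>' \<eta> \<eta>' = (\<lambda>x x' y y'. \<xi> x * \<xi>' x' * \<eta> y * \<eta>' y')"

text \<open>The definite descriptions in \<open>Omega\<close> and \<open>Pi_op\<close> have a unique solution
  when the Killing form is nondegenerate.\<close>

definition Omega :: "('g \<Rightarrow> 'g \<Rightarrow> 'f) \<Rightarrow> 'g \<Rightarrow> 'g \<Rightarrow> 'f" where
  "Omega = (\<lambda>\<sigma>\<in>symmetric_forms.
     let S = (THE S. Vector_Spaces.linear scale scale S \<and> (\<forall>x y. \<sigma> x y = killing (S x) y))
     in (\<lambda>x y. 2 * trace (Ad x \<circ> Ad y \<circ> S)))"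

definition Lambda :: "('g \<Rightarrow> 'g \<Rightarrow> 'f) \<Rightarrow> 'g \<Rightarrow> 'g \<Rightarrow> 'g \<Rightarrow> 'g \<Rightarrow> 'f" where
  "Lambda = (\<lambda>\<sigma>\<in>symmetric_forms. \<lambda>x y z z'.
     \<sigma> (bracket x y) (bracket z z') + \<sigma> (bracket y z) (bracket x z')
       + \<sigma> (bracket z x) (bracket y z'))"

definition Pi_op :: "('g \<Rightarrow> 'g \<Rightarrow> 'g \<Rightarrow> 'g \<Rightarrow> 'f) \<Rightarrow> 'g \<Rightarrow> 'g \<Rightarrow> 'f" where
  "Pi_op = (THE P. P \<in> quadrilinear_forms \<rightarrow>\<^sub>E bilinear_forms \<and>
     (\<forall>\<phi>\<in>quadrilinear_forms. \<forall>\<psi>\<in>quadrilinear_forms. \<forall>s t.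
        P (\<lambda>a b c d. s * \<phi> a b c d + t * \<psi> a b c d) = (\<lambda>u v. s * P \<phi> u v + t * P \<psi> u v)) \<and>
     (\<forall>\<xi>\<in>dual_space. \<forall>\<xi>'\<in>dual_space. \<forall>\<eta>\<in>dual_space. \<forall>\<eta>'\<in>dual_space. \<forall>x x' y y'.
        \<xi> = killing x \<and> \<xi>' = killing x' \<and> \<eta> = killing y \<and> \<eta>' = killing y' \<longrightarrow>
        P (tensor4 \<xi> \<xi>' \<eta> \<eta>') = tensor2 (killing (bracket x x')) (killing (bracket y y'))))"

definition Pi_Lambda :: "('g \<Rightarrow> 'g \<Rightarrow> 'f) \<Rightarrow> 'g \<Rightarrow> 'g \<Rightarrow> 'f" where
  "Pi_Lambda = compose symmetric_forms (restrict Pi_op exterior_4_forms) Lambda"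

text \<open>The operator \<open>T + c Id\<close> on bilinear forms.\<close>

definition plus_Id :: "(('g \<Rightarrow> 'g \<Rightarrow> 'f) \<Rightarrow> 'g \<Rightarrow> 'g \<Rightarrow> 'f) \<Rightarrow> 'f \<Rightarrow>
    ('g \<Rightarrow> 'g \<Rightarrow> 'f) \<Rightarrow> 'g \<Rightarrow> 'g \<Rightarrow> 'f" where
  "plus_Id T c \<sigma> = (\<lambda>x y. T \<sigma> x y + c * \<sigma> x y)"

lemma trace_eq:
  assumes T: "Vector_Spaces.linear scale scale T"
    and B: "independent B" "span B = UNIV"
  shows "trace T = (\<Sum>b\<in>B. representation B (T b) b)"
proof -
  interpret T: Vector_Spaces.linear scale scale T by (fact T)
  obtain F where F: "finite F" "span F = UNIV" using finite_dim by blast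
  have fin: "finite D" if "independent D" for D
    using independent_span_bound[OF F(1) that] F(2) by auto
  define C where "C = extend_basis {}"
  have C: "independent C" "span C = UNIV"
    using independent_extend_basis[of "{}"] span_extend_basis[of "{}"]
    by (simp_all add: C_def independent_empty)
  note fB = fin[OF B(1)] and fC = fin[OF C(1)]
  have exp: "(\<Sum>d\<in>D. scale (representation D v d) d) = v"
    if "independent D" "span D = UNIV" for D v
    using sum_representation_eq[OF that(1) _ fin[OF that(1)]] that by simp
  have lin: "representation D (\<Sum>i\<in>A. scale (r i) (w i)) d
      = (\<Sum>i\<in>A. r i * representation D (w i) d)"
    if "independent D" "span D = UNIV" for D d A r and w :: "'g \<Rightarrow> 'g"
    using that by (simp add: representation_sum representation_scale)
  have Texp: "T v = (\<Sum>d\<in>D. scale (representation D v d) (T d))"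
    if "independent D" "span D = UNIV" for D v
    by (subst exp[OF that, of v, symmetric]) (simp add: T.sum T.scale)
  have "trace T = (\<Sum>c\<in>C. representation C (T c) c)"
    by (simp add: trace_def C_def)
  also have "\<dots> = (\<Sum>c\<in>C. \<Sum>b\<in>B. representation B c b * representation C (T b) c)"
    by (rule sum.cong[OF refl], subst Texp[OF B], rule lin[OF C])
  also have "\<dots> = (\<Sum>b\<in>B. \<Sum>c\<in>C. representation C (T b) c * representation B c b)"
    by (subst sum.swap) (simp add: mult.commute)
  also have "\<dots> = (\<Sum>b\<in>B. representation B (T b) b)"
    by (rule sum.cong[OF refl], subst (2) exp[OF C, symmetric], rule lin[OF B, symmetric])
  finally show ?thesis .
qed

end

text \<open>Semisimple: the solvable radical is zero.\<close>

locale semisimple_lie_algebra = lie_algebra +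
  assumes solvable_ideal_zero: "ideal I \<Longrightarrow> solvable I \<Longrightarrow> I = {0}"

end

theory Submission
  imports Defs "HOL-Library.Product_Plus" "HOL-Computational_Algebra.Fundamental_Theorem_Algebra"
begin

text \<open>
  The theorem has two halves: Cartan's criterion, by which the Killing form \<open>\<beta>\<close> is nondegenerate,
  and a tensor computation that is valid whenever \<open>\<beta>\<close> is nondegenerate.

  For the criterion let \<open>R\<close> be the radical of \<open>\<beta>\<close>, an ideal, and let \<open>x\<close> be a sum of brackets of
  elements of \<open>R\<close>.  Over the complex numbers the generalized eigenspaces of \<open>Ad x\<close> grade the Lie
  algebra by the eigenvalue, so the operator \<open>D\<close> that multiplies each of them by the conjugate
  eigenvalue is a derivation.  The trace of \<open>Ad x \<circ> D\<close> vanishes by cyclicity, because \<open>R\<close> is the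
  radical of \<open>\<beta>\<close>, and it is the sum of the squared absolute values of the eigenvalues; hence
  \<open>Ad x\<close> is nilpotent.  Over the real numbers the same follows by complexification.  The derived
  series of \<open>R\<close> becomes stationary at a perfect subalgebra of ad-nilpotent elements, which is zero
  by Engel's theorem (\<open>perfect_Ad_nilpotent_imp_zero\<close>).  Thus \<open>R\<close> is a solvable ideal, and
  semisimplicity forces it to be zero (\<open>killing_radical_zero\<close>).

  For the computation let \<open>b\<close> run over a basis and \<open>dual b\<close> over the dual basis with respect to
  \<open>\<beta>\<close>.  The Casimir tensor \<open>\<Sum> b \<otimes> dual b\<close> is symmetric and invariant, and its image in the adjoint
  representation is the identity.  With \<open>(C \<sigma>)(x, y) = \<Sum> \<sigma>([b, x], [dual b, y])\<close> one finds
  \<open>\<Omega> = - 2 C\<close> (\<open>Omega_eq_casimir_op\<close>) and \<open>\<Pi>\<Lambda> = Id - C - 2 C\<^sup>2\<close> (\<open>pi_form_Lambda\<close>).  Since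
  \<open>(- 2 C + Id) (- 2 C - 2 Id) = 4 C\<^sup>2 + 2 C - 2 Id\<close>, this is the assertion.
\<close>

section \<open>Lie algebras and their trace form\<close>

context lie_algebra
begin

abbreviation lin :: "('g \<Rightarrow> 'g) \<Rightarrow> bool" where
  "lin \<equiv> Vector_Spaces.linear scale scale"

lemma lin_add: "lin T \<Longrightarrow> T (x + y) = T x + T y"
  and lin_scale: "lin T \<Longrightarrow> T (scale c x) = scale c (T x)"
  and lin_zero: "lin T \<Longrightarrow> T 0 = 0"
  and lin_minus: "lin T \<Longrightarrow> T (- x) = - T x"
  and lin_diff: "lin T \<Longrightarrow> T (x - y) = T x - T y"
  and lin_sum: "lin T \<Longrightarrow> T (sum f A) = (\<Sum>i\<in>A. T (f i))"
  using module_hom.add[of scale scale T] module_hom.scale[of scale scale T]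
    module_hom.zero[of scale scale T] module_hom.neg[of scale scale T]
    module_hom.diff[of scale scale T] module_hom.sum[of scale scale T]
  unfolding module_hom_iff_linear by blast+

lemma linI: "(\<And>x y. T (x + y) = T x + T y) \<Longrightarrow> (\<And>c x. T (scale c x) = scale c (T x)) \<Longrightarrow> lin T"
  unfolding Vector_Spaces.linear_iff using vector_space_axioms by blast

lemmas bracket_add_left = lin_add[OF linear_bracket_left]
  and bracket_add_right = lin_add[OF linear_bracket_right]
  and bracket_scale_left = lin_scale[OF linear_bracket_left]
  and bracket_scale_right = lin_scale[OF linear_bracket_right]
  and bracket_minus_left = lin_minus[OF linear_bracket_left]
  and bracket_minus_right = lin_minus[OF linear_bracket_right]
  and bracket_diff_left = lin_diff[OF linear_bracket_left]
  and bracket_diff_right = lin_diff[OF linear_bracket_right]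

lemma bracket_zero [simp]: "bracket 0 x = 0" "bracket x 0 = 0"
  by (rule lin_zero[OF linear_bracket_left] lin_zero[OF linear_bracket_right])+

lemma bracket_swap: "bracket x y = - bracket y x"
proof -
  have "bracket (x + y) (x + y) = bracket x y + bracket y x"
    unfolding bracket_add_left bracket_add_right by (simp add: bracket_self)
  then show ?thesis
    unfolding bracket_self eq_neg_iff_add_eq_0 by simp
qed

lemma Ad_derivation: "bracket x (bracket y z) = bracket (bracket x y) z + bracket y (bracket x z)"
  using jacobi[of x y z]
  unfolding bracket_swap[of z "bracket x y"] bracket_swap[of z x] bracket_minus_right
  by (simp add: algebra_simps)

lemma Ad_bracket: "bracket (bracket x y) z = bracket x (bracket y z) - bracket y (bracket x z)"
  using Ad_derivation[of x y z] by simp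

lemma lin_ident: "lin (\<lambda>x. x)"
  by (rule linI) auto

lemma lin_bracket_left: "lin f \<Longrightarrow> lin (\<lambda>x. bracket (f x) y)"
  and lin_bracket_right: "lin f \<Longrightarrow> lin (\<lambda>x. bracket y (f x))"
  by (auto intro!: linI simp: lin_add lin_scale bracket_add_left bracket_add_right
      bracket_scale_left bracket_scale_right)

lemma lin_compose: "lin S \<Longrightarrow> lin T \<Longrightarrow> lin (S \<circ> T)"
  by (auto intro!: linI simp: lin_add lin_scale)

lemmas lin_intros = lin_ident lin_bracket_left lin_bracket_right lin_compose

sublocale finite_dimensional_vector_space scale "extend_basis {}"
proof
  obtain F where F: "finite F" "span F = UNIV" using finite_dim by blast
  show indep: "independent (extend_basis {})"
    by (rule independent_extend_basis) (rule independent_empty)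
  show "finite (extend_basis {})"
    using independent_span_bound[OF F(1) indep] F(2) by auto
  show "span (extend_basis {}) = UNIV"
    by (simp add: independent_empty)
qed

abbreviation basis :: "'g set" where
  "basis \<equiv> extend_basis {}"

lemma basis_expansion: "v = (\<Sum>b\<in>basis. scale (representation basis v b) b)"
  using sum_representation_eq[OF independent_Basis _ finite_Basis] by (simp add: span_Basis)

lemma representation_basis_linear:
  "representation basis (x + y) b = representation basis x b + representation basis y b"
  "representation basis (x - y) b = representation basis x b - representation basis y b"
  "representation basis (scale c x) b = c * representation basis x b"
  "representation basis (sum f A) b = (\<Sum>i\<in>A. representation basis (f i) b)"
  using independent_Basis span_Basis
  by (simp_all add: representation_add representation_diff representation_scale representation_sum)

lemma trace_add: "trace (\<lambda>v. S v + T v) = trace S + trace T"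
  and trace_diff: "trace (\<lambda>v. S v - T v) = trace S - trace T"
  and trace_scale: "trace (\<lambda>v. scale c (T v)) = c * trace T"
  by (simp_all add: trace_def representation_basis_linear sum.distrib sum_subtractf sum_distrib_left)

text \<open>In coordinates both traces are the double sum of the products of opposite matrix entries.\<close>

lemma trace_compose_swap:
  assumes S: "lin S" and T: "lin T"
  shows "trace (S \<circ> T) = trace (T \<circ> S)"
proof -
  let ?r = "representation basis"
  have exp: "trace (S \<circ> T) = (\<Sum>b\<in>basis. \<Sum>c\<in>basis. ?r (T b) c * ?r (S c) b)" if "lin S" for S T
  proof -
    have "?r (S (T b)) b = (\<Sum>c\<in>basis. ?r (T b) c * ?r (S c) b)" for b
      by (subst basis_expansion[of "T b"])
        (simp only: lin_sum[OF that] lin_scale[OF that] representation_basis_linear)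
    then show ?thesis by (simp add: trace_def)
  qed
  show ?thesis
    unfolding exp[OF S] exp[OF T] by (subst sum.swap) (simp add: mult.commute)
qed

lemma trace_commutator_swap:
  assumes "lin A" "lin B" "lin D"
  shows "trace (\<lambda>v. A (B (D v)) - B (A (D v))) = trace (\<lambda>v. A (B (D v) - D (B v)))"
proof -
  have "trace (B \<circ> (A \<circ> D)) = trace ((A \<circ> D) \<circ> B)"
    by (rule trace_compose_swap) (use assms in \<open>auto intro: lin_compose\<close>)
  then show ?thesis
    using assms by (simp add: trace_diff lin_diff o_def)
qed

lemma killing_commute: "killing x y = killing y x"
  unfolding killing_def by (intro trace_compose_swap linear_bracket_right)

lemma killing_add_left: "killing (x + y) z = killing x z + killing y z"
  and killing_scale_left: "killing (scale c x) z = c * killing x z"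
  by (simp_all add: killing_def o_def bracket_add_left bracket_scale_left trace_add trace_scale)

text \<open>Cyclicity of the trace turns the commutator of two adjoint operators into the invariance
  of the Killing form.\<close>

lemma killing_invariant: "killing (bracket x y) z = killing x (bracket y z)"
proof -
  have "killing (bracket x y) z = trace (\<lambda>v. Ad x (Ad y (Ad z v)) - Ad y (Ad x (Ad z v)))"
    by (simp add: killing_def o_def Ad_bracket)
  also have "\<dots> = trace (\<lambda>v. Ad x (Ad y (Ad z v) - Ad z (Ad y v)))"
    by (rule trace_commutator_swap) (intro linear_bracket_right)+
  also have "\<dots> = killing x (bracket y z)"
    by (simp add: killing_def o_def Ad_bracket)
  finally show ?thesis .
qed

lemma dual_space_iff:
  "\<xi> \<in> dual_space \<longleftrightarrow> (\<forall>x y. \<xi> (x + y) = \<xi> x + \<xi> y) \<and> (\<forall>c x. \<xi> (scale c x) = c * \<xi> x)"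
proof -
  have "vector_space ((*) :: 'f \<Rightarrow> 'f \<Rightarrow> 'f)"
    by unfold_locales (simp_all add: algebra_simps)
  then show ?thesis
    by (simp add: dual_space_def Vector_Spaces.linear_iff vector_space_axioms)
qed

lemma killing_add_right: "killing z (x + y) = killing z x + killing z y"
  and killing_scale_right: "killing z (scale c x) = c * killing z x"
  unfolding killing_commute[of z] by (rule killing_add_left killing_scale_left)+

lemma killing_dual: "killing x \<in> dual_space"
  by (simp add: dual_space_iff killing_add_right killing_scale_right)

section \<open>Ad-nilpotent subalgebras\<close>

lemma exists_max_dim:
  assumes "P U"
  obtains V where "P V" and "\<And>W. P W \<Longrightarrow> dim W \<le> dim V"
  using ex_has_greatest_nat[of P U dim "Suc dimension"] dim_subset_UNIV assms
  by (metis less_Suc_eq_le)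

definition stable :: "'g set \<Rightarrow> 'g set \<Rightarrow> bool" where
  "stable K U \<longleftrightarrow> subspace U \<and> (\<forall>k\<in>K. \<forall>u\<in>U. bracket k u \<in> U)"

text \<open>The conclusion of Engel's theorem for all subquotients \<open>W / U\<close> of the adjoint representation:
  the vector \<open>w\<close> represents a nonzero vector of \<open>W / U\<close> that is killed by \<open>K\<close>.  Phrasing it with
  pairs of subspaces avoids quotient types.\<close>

definition engel :: "'g set \<Rightarrow> bool" where
  "engel K \<longleftrightarrow> (\<forall>U W. stable K U \<longrightarrow> stable K W \<longrightarrow> U \<subset> W \<longrightarrow>
     (\<exists>w\<in>W - U. \<forall>k\<in>K. bracket k w \<in> U))"

text \<open>The vectors of \<open>W / U\<close> killed by \<open>K\<close> form a space stable under \<open>x\<close>, since \<open>x\<close> normalizes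
  \<open>K\<close>; on it the nilpotent operator \<open>Ad x\<close> kills some nonzero vector.\<close>

lemma engel_insert:
  assumes K: "engel K" and norm: "\<And>k. k \<in> K \<Longrightarrow> bracket k x \<in> K"
    and nil: "\<And>v. \<exists>m. (Ad x ^^ m) v = 0"
  shows "engel (span (insert x K))"
  unfolding engel_def
proof (intro allI impI)
  fix U W assume U: "stable (span (insert x K)) U" and W: "stable (span (insert x K)) W" and UW: "U \<subset> W"
  have sub: "insert x K \<subseteq> span (insert x K)" by (rule span_superset)
  then have "stable K U" "stable K W" using U W unfolding stable_def by blast+
  then obtain w where w: "w \<in> W - U" "\<forall>k\<in>K. bracket k w \<in> U"
    using K UW unfolding engel_def by blast
  have Us: "subspace U" and xU: "\<And>u. u \<in> U \<Longrightarrow> bracket x u \<in> U"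
    and KU: "\<And>k u. k \<in> K \<Longrightarrow> u \<in> U \<Longrightarrow> bracket k u \<in> U" and xW: "\<And>u. u \<in> W \<Longrightarrow> bracket x u \<in> W"
    using U W sub unfolding stable_def by blast+
  have pow: "(Ad x ^^ m) w \<in> W \<and> (\<forall>k\<in>K. bracket k ((Ad x ^^ m) w) \<in> U)" for m
  proof (induction m)
    case 0
    then show ?case using w by simp
  next
    case (Suc m)
    let ?v = "(Ad x ^^ m) w"
    have "bracket k (bracket x ?v) \<in> U" if "k \<in> K" for k
    proof -
      have "bracket k x \<in> K" using norm that by blast
      then have "bracket (bracket k x) ?v \<in> U" "bracket x (bracket k ?v) \<in> U"
        using Suc that xU by blast+
      then show ?thesis
        unfolding Ad_derivation[of k x] by (rule subspace_add[OF Us])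
    qed
    then show ?case using Suc xW by simp
  qed
  define m where "m = (LEAST m. (Ad x ^^ m) w \<in> U)"
  obtain m0 where "(Ad x ^^ m0) w \<in> U"
    using nil[of w] subspace_0[OF Us] by metis
  then have m: "(Ad x ^^ m) w \<in> U" unfolding m_def by (rule LeastI)
  have "m \<noteq> 0" using m w by (metis DiffD2 funpow_0)
  then obtain n where n: "m = Suc n" using not0_implies_Suc by blast
  let ?v = "(Ad x ^^ n) w"
  have "?v \<notin> U" using not_less_Least[of n "\<lambda>m. (Ad x ^^ m) w \<in> U", folded m_def] n by simp
  moreover have "bracket k ?v \<in> U" if "k \<in> span (insert x K)" for k
    using that
  proof (induction rule: span_induct_alt)
    case base
    then show ?case using subspace_0[OF Us] by simp
  next
    case (step c y z)
    have "bracket y ?v \<in> U" using step(1) m n pow[of n] by auto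
    with step show ?case
      by (simp add: bracket_add_left bracket_scale_left subspace_add[OF Us] subspace_scale[OF Us])
  qed
  ultimately show "\<exists>w\<in>W - U. \<forall>k\<in>span (insert x K). bracket k w \<in> U"
    using pow[of n] by blast
qed

definition subalgebra :: "'g set \<Rightarrow> bool" where
  "subalgebra K \<longleftrightarrow> subspace K \<and> (\<forall>x\<in>K. \<forall>y\<in>K. bracket x y \<in> K)"

lemma subalgebra_span_insert:
  assumes K: "subalgebra K" and norm: "\<And>k. k \<in> K \<Longrightarrow> bracket k x \<in> K"
  shows "subalgebra (span (insert x K))"
proof -
  have Ks: "subspace K" and KK: "\<And>k l. k \<in> K \<Longrightarrow> l \<in> K \<Longrightarrow> bracket k l \<in> K"
    using K unfolding subalgebra_def by blast+
  have norm': "bracket x k \<in> K" if "k \<in> K" for k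
    using subspace_neg[OF Ks norm[OF that]] bracket_swap[of x k] by simp
  have gen: "bracket y z \<in> K" if "y \<in> insert x K" "z \<in> insert x K" for y z
    using that KK norm norm' subspace_0[OF Ks] bracket_self by auto
  have gen_left: "bracket y z \<in> K" if "y \<in> span (insert x K)" "z \<in> insert x K" for y z
    using that(1)
  proof (induction rule: span_induct_alt)
    case base
    then show ?case using subspace_0[OF Ks] by simp
  next
    case (step c u v)
    then show ?case using gen[of u z] that(2)
      by (simp add: bracket_add_left bracket_scale_left subspace_add[OF Ks] subspace_scale[OF Ks])
  qed
  have "bracket y z \<in> K" if "z \<in> span (insert x K)" "y \<in> span (insert x K)" for y z
    using that(1)
  proof (induction rule: span_induct_alt)
    case base
    then show ?case using subspace_0[OF Ks] by simp
  next
    case (step c u v)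
    then show ?case using gen_left[OF that(2), of u]
      by (simp add: bracket_add_right bracket_scale_right subspace_add[OF Ks] subspace_scale[OF Ks])
  qed
  moreover have "K \<subseteq> span (insert x K)"
    using span_superset[of "insert x K"] by blast
  ultimately show ?thesis
    unfolding subalgebra_def by (meson subsetD subspace_span)
qed

text \<open>A subalgebra \<open>K\<close> of largest dimension among those with the Engel property is all of \<open>J\<close>:
  otherwise the Engel property, applied to \<open>J / K\<close>, yields an element by which \<open>K\<close> can be
  enlarged.\<close>

theorem engel_if_Ad_nilpotent:
  assumes J: "subalgebra J" and nil: "\<And>x v. x \<in> J \<Longrightarrow> \<exists>m. (Ad x ^^ m) v = 0"
  shows "engel J"
proof -
  define good where "good K \<longleftrightarrow> subalgebra K \<and> engel K \<and> K \<subseteq> J" for K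
  have Js: "subspace J" using J unfolding subalgebra_def by blast
  have "good {0}"
    using subspace_0[OF Js]
    by (auto simp: good_def subalgebra_def engel_def stable_def subspace_0)
  then obtain K where K: "good K" and max: "\<And>L. good L \<Longrightarrow> dim L \<le> dim K"
    using exists_max_dim[of good "{0}"] by blast
  have "K = J"
  proof (rule ccontr)
    assume "K \<noteq> J"
    then have "K \<subset> J" "stable K K" "stable K J"
      using K J unfolding good_def stable_def subalgebra_def by auto
    then obtain x where x: "x \<in> J" "x \<notin> K" "\<And>k. k \<in> K \<Longrightarrow> bracket k x \<in> K"
      using K unfolding good_def engel_def by blast
    let ?L = "span (insert x K)"
    have "?L \<subseteq> J"
      using x K Js unfolding good_def by (intro span_minimal) auto
    then have "good ?L"
      using K x nil unfolding good_def by (intro conjI subalgebra_span_insert engel_insert) auto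
    moreover have "dim K < dim ?L"
    proof (rule dim_psubset)
      have "span K = K" using K unfolding good_def subalgebra_def by simp
      then show "span K \<subset> span ?L"
        using span_superset[of "insert x K"] x(2) unfolding span_span by blast
    qed
    ultimately show False using max by fastforce
  qed
  then show ?thesis using K good_def by blast
qed

text \<open>By Engel's theorem a maximal proper stable subspace \<open>U\<close> of \<open>J\<close> has codimension one, and
  \<open>J\<close> acts on the line \<open>J / U\<close> as zero, so that \<open>U\<close> contains all brackets.\<close>

theorem perfect_Ad_nilpotent_imp_zero:
  assumes Js: "subspace J" and perfect: "span {bracket x y | x y. x \<in> J \<and> y \<in> J} = J"
    and nil: "\<And>x v. x \<in> J \<Longrightarrow> \<exists>m. (Ad x ^^ m) v = 0"
  shows "J = {0}"
proof (rule ccontr)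
  assume J0: "J \<noteq> {0}"
  have JJ: "bracket x y \<in> J" if "x \<in> J" "y \<in> J" for x y
    using that perfect span_superset[of "{bracket x y | x y. x \<in> J \<and> y \<in> J}"] by blast
  then have "engel J"
    using Js nil by (intro engel_if_Ad_nilpotent) (auto simp: subalgebra_def)
  define good where "good U \<longleftrightarrow> stable J U \<and> U \<subset> J" for U
  have "good {0}"
    using subspace_0[OF Js] J0 by (auto simp: good_def stable_def)
  then obtain U where U: "good U" and max: "\<And>L. good L \<Longrightarrow> dim L \<le> dim U"
    using exists_max_dim[of good "{0}"] by blast
  have Us: "subspace U" using U unfolding good_def stable_def by blast
  have "stable J J" using Js JJ unfolding stable_def by blast
  then obtain w where w: "w \<in> J" "w \<notin> U" "\<And>k. k \<in> J \<Longrightarrow> bracket k w \<in> U"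
    using \<open>engel J\<close>[unfolded engel_def, rule_format, of U J] U[unfolded good_def] by blast
  let ?L = "span (insert w U)"
  have act: "bracket k y \<in> U" if "k \<in> J" "y \<in> ?L" for k y
    using that(2)
  proof (induction rule: span_induct_alt)
    case base
    then show ?case using subspace_0[OF Us] by simp
  next
    case (step c u v)
    have "bracket k u \<in> U" using step(1) w(3) that(1) U unfolding good_def stable_def by auto
    with step show ?case
      by (simp add: bracket_add_right bracket_scale_right subspace_add[OF Us] subspace_scale[OF Us])
  qed
  have UL: "U \<subseteq> ?L" "w \<in> ?L" using span_superset[of "insert w U"] by auto
  have LJ: "?L \<subseteq> J" using w(1) U Js unfolding good_def by (intro span_minimal) auto
  have "dim U < dim ?L"
  proof (rule dim_psubset)
    have "span U = U" using Us by simp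
    then show "span U \<subset> span ?L" using UL w(2) unfolding span_span by blast
  qed
  then have "\<not> good ?L" using max by fastforce
  moreover have "stable J ?L" using act UL unfolding stable_def by blast
  ultimately have "?L = J" using LJ unfolding good_def by blast
  then have "span {bracket x y | x y. x \<in> J \<and> y \<in> J} \<subseteq> U"
    using act Us by (intro span_minimal) auto
  then show False using perfect U unfolding good_def by blast
qed

end

section \<open>Triangular form of a complex operator\<close>

locale complex_operator = finite_dimensional_vector_space scale Basis
  for scale :: "complex \<Rightarrow> 'v::ab_group_add \<Rightarrow> 'v" and Basis +
  fixes T :: "'v \<Rightarrow> 'v"
  assumes linear_T: "Vector_Spaces.linear scale scale T"
begin

lemma T_add: "T (x + y) = T x + T y"
  and T_scale: "T (scale c x) = scale c (T x)"
  and T_zero: "T 0 = 0"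
  and T_diff: "T (x - y) = T x - T y"
  using linear_T module_hom.add[of scale scale T] module_hom.scale[of scale scale T]
    module_hom.zero[of scale scale T] module_hom.diff[of scale scale T]
  unfolding module_hom_iff_linear by blast+

definition peval :: "complex poly \<Rightarrow> 'v \<Rightarrow> 'v" where
  "peval p v = (\<Sum>i\<le>degree p. scale (coeff p i) ((T ^^ i) v))"

lemma T_sum: "T (sum f A) = (\<Sum>i\<in>A. T (f i))"
  by (induction A rule: infinite_finite_induct) (simp_all add: T_zero T_add)

lemma peval_0 [simp]: "peval 0 v = 0"
  by (simp add: peval_def)

lemma peval_pCons: "peval (pCons a p) v = scale a v + T (peval p v)"
proof (cases "p = 0")
  case True
  then show ?thesis by (simp add: peval_def T_zero)
next
  case False
  then show ?thesis
    unfolding peval_def by (simp add: sum.atMost_Suc_shift T_sum T_scale del: sum.atMost_Suc)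
qed

lemma peval_add: "peval (p + q) v = peval p v + peval q v"
  by (induction p q rule: poly_induct2) (simp_all add: peval_pCons T_add scale_left_distrib)

lemma peval_smult: "peval (smult c p) v = scale c (peval p v)"
  by (induction p) (simp_all add: peval_pCons T_scale scale_right_distrib)

lemma peval_diff: "peval (p - q) v = peval p v - peval q v"
  by (induction p q rule: poly_induct2) (simp_all add: peval_pCons T_diff scale_left_diff_distrib)

lemma peval_monom: "peval (monom c i) v = scale c ((T ^^ i) v)"
  by (induction i) (simp_all add: monom_0 monom_Suc peval_pCons T_zero T_scale)

lemma peval_linear_factor: "peval ([:- z, 1:] * q) v = T (peval q v) - scale z (peval q v)"
  by (simp add: peval_diff peval_smult peval_pCons)

text \<open>Among more iterates of \<open>v\<close> than the dimension allows to be independent, some iterate is a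
  combination of the earlier ones.\<close>

lemma exists_annihilating_poly: "\<exists>p. p \<noteq> 0 \<and> peval p v = 0"
proof -
  let ?f = "\<lambda>i. (T ^^ i) v"
  have "\<exists>m. ?f m \<in> span (?f ` {..<m})"
  proof (rule ccontr)
    assume no: "\<nexists>m. ?f m \<in> span (?f ` {..<m})"
    have "independent (?f ` {..<m}) \<and> card (?f ` {..<m}) = m" for m
    proof (induction m)
      case (Suc m)
      have "?f m \<notin> ?f ` {..<m}" using no span_base by metis
      then show ?case
        using Suc no independent_insertI[of "?f m" "?f ` {..<m}"]
        by (simp add: lessThan_Suc del: funpow.simps)
    qed (simp add: independent_empty)
    from this[of "Suc (dim UNIV)"] show False
      using independent_card_le_dim[of "?f ` {..<Suc (dim UNIV)}" UNIV] by simp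
  qed
  then obtain m where m: "?f m \<in> span (?f ` {..<m})" by blast
  have "\<exists>q. (\<forall>i\<ge>m. coeff q i = 0) \<and> peval q v = u" if "u \<in> span (?f ` {..<m})" for u
    using that
  proof (induction rule: span_induct_alt)
    case base
    then show ?case by (intro exI[of _ 0]) simp
  next
    case (step c x y)
    then obtain q i where q: "\<forall>i\<ge>m. coeff q i = 0" "peval q v = y" and i: "i < m" "x = ?f i"
      by blast
    then have "(\<forall>j\<ge>m. coeff (monom c i + q) j = 0) \<and> peval (monom c i + q) v = scale c x + y"
      by (auto simp: peval_add peval_monom)
    then show ?case by blast
  qed
  with m obtain q where q: "\<forall>i\<ge>m. coeff q i = 0" "peval q v = ?f m" by blast
  let ?p = "monom 1 m + smult (- 1) q"
  have "coeff ?p m \<noteq> 0" using q by simp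
  then have "?p \<noteq> 0" by (metis coeff_0)
  moreover have "peval ?p v = 0"
    unfolding peval_add peval_smult peval_monom q by simp
  ultimately show ?thesis by blast
qed

text \<open>Take a polynomial of least degree that moves a vector outside \<open>W\<close> into \<open>W\<close>, and split
  off a linear factor.\<close>

lemma exists_eigenvector_modulo:
  assumes W: "subspace W" "W \<noteq> UNIV"
  obtains v z where "v \<notin> W" "T v - scale z v \<in> W"
proof -
  define P where "P m \<longleftrightarrow> (\<exists>p v. p \<noteq> 0 \<and> degree p = m \<and> v \<notin> W \<and> peval p v \<in> W)" for m
  obtain v0 where "v0 \<notin> W" using W(2) by blast
  moreover obtain p0 where "p0 \<noteq> 0" "peval p0 v0 = 0" using exists_annihilating_poly by blast
  ultimately have "P (degree p0)"
    unfolding P_def using subspace_0[OF W(1)] by metis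
  then have least: "P (LEAST m. P m)" by (rule LeastI)
  then obtain p v where p: "p \<noteq> 0" "degree p = (LEAST m. P m)" "v \<notin> W" "peval p v \<in> W"
    unfolding P_def by blast
  have "degree p \<noteq> 0"
  proof
    assume "degree p = 0"
    then obtain a where a: "p = [:a:]" by (meson degree_eq_zeroE)
    then have "a \<noteq> 0" "scale a v \<in> W" using p by (auto simp: peval_pCons T_zero)
    then show False using subspace_scale[OF W(1), of "scale a v" "1 / a"] p(3) by simp
  qed
  then obtain z where "poly p z = 0"
    using fundamental_theorem_of_algebra_alt[of p] degree_pCons_0 by metis
  then obtain q where q: "p = [:- z, 1:] * q"
    using poly_eq_0_iff_dvd by (auto simp: dvd_def)
  have q0: "q \<noteq> 0" using q p(1) by auto
  then have "degree p = Suc (degree q)"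
    unfolding q by (subst degree_mult_eq) auto
  then have "\<not> P (degree q)" using not_less_Least[of "degree q" P] p(2) by simp
  then have "peval q v \<notin> W" using q0 p(3) unfolding P_def by blast
  moreover have "T (peval q v) - scale z (peval q v) \<in> W"
    using p(4) unfolding q peval_linear_factor .
  ultimately show thesis by (rule that)
qed

text \<open>The condition \<open>lam j = lam i\<close> lets \<open>T\<close> mix only vectors of the same eigenvalue, so that
  every \<open>b i\<close> is a generalized eigenvector and not only part of a triangular basis.\<close>

definition triangular :: "nat \<Rightarrow> (nat \<Rightarrow> 'v) \<Rightarrow> (nat \<Rightarrow> complex) \<Rightarrow> bool" where
  "triangular n b lam \<longleftrightarrow> inj_on b {..<n} \<and> independent (b ` {..<n}) \<and>
     (\<forall>i<n. T (b i) - scale (lam i) (b i) \<in> span (b ` {j. j < i \<and> lam j = lam i}))"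

text \<open>An operator of the form \<open>T - z\<close> is onto modulo the part with eigenvalue \<open>z\<close>. Therefore an
  eigenvector modulo the span \<open>W\<close> of the vectors found so far can be corrected inside \<open>W\<close>
  until its defect lies in the part with its own eigenvalue.\<close>

lemma triangular_extend:
  assumes tri: "triangular n b lam" and proper: "span (b ` {..<n}) \<noteq> UNIV"
  obtains v z where "triangular (Suc n) (b(n := v)) (lam(n := z))"
proof -
  let ?W = "span (b ` {..<n})"
  obtain v z where v: "v \<notin> ?W" "T v - scale z v \<in> ?W"
    using exists_eigenvector_modulo[OF subspace_span proper] by blast
  define S where "S x = T x - scale z x" for x
  define R where "R = span (b ` {j. j < n \<and> lam j = z})"
  have S: "S (x + y) = S x + S y" "S (scale c x) = scale c (S x)" "S 0 = 0" for x y c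
    by (simp_all add: S_def T_add T_scale T_zero algebra_simps)
  \<comment> \<open>the vectors that lie in the image of \<open>T - z\<close> up to the part with eigenvalue \<open>z\<close>\<close>
  define G where "G = {w. \<exists>w'\<in>?W. w - S w' \<in> R}"
  have G: "subspace G"
  proof (rule subspaceI)
    have "0 - S 0 \<in> R" by (simp add: S R_def span_zero)
    then show "0 \<in> G" unfolding G_def using span_zero by blast
  next
    fix x y assume "x \<in> G" "y \<in> G"
    then obtain x' y' where "x' \<in> ?W" "y' \<in> ?W" "x - S x' \<in> R" "y - S y' \<in> R"
      unfolding G_def by blast
    then have "x' + y' \<in> ?W" "x + y - S (x' + y') \<in> R"
      using span_add[of "x - S x'" _ "y - S y'"] unfolding R_def S
      by (auto simp: algebra_simps intro: span_add)
    then show "x + y \<in> G" unfolding G_def by blast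
  next
    fix c x assume "x \<in> G"
    then obtain x' where "x' \<in> ?W" "x - S x' \<in> R"
      unfolding G_def by blast
    then have "scale c x' \<in> ?W" "scale c x - S (scale c x') \<in> R"
      using span_scale[of "x - S x'" _ c] unfolding R_def S
      by (auto simp: scale_right_diff_distrib intro: span_scale)
    then show "scale c x \<in> G" unfolding G_def by blast
  qed
  have "b i \<in> G" if "i < n" for i
    using that
  proof (induction i rule: less_induct)
    case (less i)
    show ?case
    proof (cases "lam i = z")
      case True
      then have "b i - S 0 \<in> R" using less.prems by (auto simp: S R_def intro!: span_base)
      then show ?thesis unfolding G_def using span_zero by blast
    next
      case False
      define r where "r = T (b i) - scale (lam i) (b i)"
      define c where "c = 1 / (lam i - z)"
      have "r \<in> span (b ` {j. j < i \<and> lam j = lam i})"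
        using tri less.prems by (simp add: triangular_def r_def)
      moreover have "span (b ` {j. j < i \<and> lam j = lam i}) \<subseteq> G"
        using less by (intro span_minimal G) auto
      ultimately have "r \<in> G" by blast
      have Sb: "S (b i) = scale (lam i - z) (b i) + r"
        by (simp add: S_def r_def scale_left_diff_distrib)
      have "S (scale c (b i)) - S (scale c (b i)) \<in> R" by (simp add: R_def span_zero)
      moreover have "scale c (b i) \<in> ?W" using less.prems by (intro span_scale span_base) auto
      ultimately have "S (scale c (b i)) \<in> G" unfolding G_def by blast
      moreover have "b i = S (scale c (b i)) - scale c r"
        using False by (simp add: S Sb scale_right_distrib c_def)
      ultimately show ?thesis
        using \<open>r \<in> G\<close> subspace_diff[OF G] subspace_scale[OF G] by metis
    qed
  qed
  then have "?W \<subseteq> G" by (intro span_minimal G) auto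
  then obtain w where w: "w \<in> ?W" "S v - S w \<in> R"
    using v(2) unfolding G_def S_def by auto
  let ?v = "v - w" and ?b = "b(n := v - w)" and ?lam = "lam(n := z)"
  have v': "?v \<notin> ?W" using v(1) w(1) span_add[of ?v _ w] by auto
  have "S ?v \<in> R" using w(2) by (simp add: S_def T_diff algebra_simps)
  moreover have im: "?b ` {j. j < i \<and> ?lam j = c} = b ` {j. j < i \<and> lam j = c}" if "i \<le> n" for i c
    using that by (intro image_cong) auto
  ultimately have "T (?b n) - scale (?lam n) (?b n) \<in> span (?b ` {j. j < n \<and> ?lam j = ?lam n})"
    by (simp add: S_def R_def)
  moreover have "T (?b i) - scale (?lam i) (?b i) \<in> span (?b ` {j. j < i \<and> ?lam j = ?lam i})"
    if "i < n" for i
    using tri that im[of i] by (simp add: triangular_def)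
  ultimately have defect: "T (?b i) - scale (?lam i) (?b i) \<in> span (?b ` {j. j < i \<and> ?lam j = ?lam i})"
    if "i < Suc n" for i
    using that by (cases "i = n") auto
  have im_b: "?b ` {..<Suc n} = insert ?v (b ` {..<n})" by (auto simp: lessThan_Suc)
  have ind: "inj_on b {..<n}" "independent (b ` {..<n})" using tri by (simp_all add: triangular_def)
  have "inj_on ?b {..<n}" using ind(1) by (simp add: inj_on_def)
  moreover have "?b n \<notin> ?b ` ({..<n} - {n})"
  proof -
    have "?b ` ({..<n} - {n}) = b ` {..<n}" by auto
    then show ?thesis using v' span_base by auto
  qed
  ultimately have "inj_on ?b {..<Suc n}"
    unfolding lessThan_Suc inj_on_insert by blast
  moreover have "independent (?b ` {..<Suc n})"
    unfolding im_b by (rule independent_insertI[OF v' ind(2)])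
  ultimately have "triangular (Suc n) ?b ?lam"
    using defect unfolding triangular_def by blast
  then show thesis by (rule that)
qed

theorem triangular_exists: "\<exists>n b lam. triangular n b lam \<and> span (b ` {..<n}) = UNIV"
proof (rule ccontr)
  assume no: "\<nexists>n b lam. triangular n b lam \<and> span (b ` {..<n}) = UNIV"
  have "\<exists>b lam. triangular n b lam" for n
  proof (induction n)
    case 0
    then show ?case by (simp add: triangular_def independent_empty)
  next
    case (Suc n)
    then show ?case using no triangular_extend by metis
  qed
  then obtain b lam where "triangular (Suc (dim UNIV)) b lam" by blast
  then show False
    using independent_card_le_dim[of "b ` {..<Suc (dim UNIV)}" UNIV]
    by (simp add: triangular_def card_image)
qed

definition gen_eigenspace :: "complex \<Rightarrow> 'v set" where
  "gen_eigenspace \<mu> = {v. \<exists>N. ((\<lambda>v. T v - scale \<mu> v) ^^ N) v = 0}"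

lemma gen_eigenspace_step:
  "T v - scale \<mu> v \<in> gen_eigenspace \<mu> \<longleftrightarrow> v \<in> gen_eigenspace \<mu>"
proof
  assume "T v - scale \<mu> v \<in> gen_eigenspace \<mu>"
  then obtain N where "((\<lambda>v. T v - scale \<mu> v) ^^ N) (T v - scale \<mu> v) = 0"
    unfolding gen_eigenspace_def by blast
  then have "((\<lambda>v. T v - scale \<mu> v) ^^ Suc N) v = 0" unfolding funpow_Suc_right o_apply .
  then show "v \<in> gen_eigenspace \<mu>" unfolding gen_eigenspace_def by blast
next
  assume "v \<in> gen_eigenspace \<mu>"
  then obtain N where "((\<lambda>v. T v - scale \<mu> v) ^^ N) v = 0"
    unfolding gen_eigenspace_def by blast
  then have "((\<lambda>v. T v - scale \<mu> v) ^^ N) (T v - scale \<mu> v) = 0"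
    using T_zero funpow_swap1[of "\<lambda>v. T v - scale \<mu> v" N v] by simp
  then show "T v - scale \<mu> v \<in> gen_eigenspace \<mu>" unfolding gen_eigenspace_def by blast
qed

lemma subspace_gen_eigenspace: "subspace (gen_eigenspace \<mu>)"
proof -
  let ?S = "\<lambda>v. T v - scale \<mu> v"
  have add: "(?S ^^ N) (x + y) = (?S ^^ N) x + (?S ^^ N) y" for N x y
    by (induction N) (simp_all add: T_add algebra_simps)
  have scl: "(?S ^^ N) (scale c x) = scale c ((?S ^^ N) x)" for N c x
    by (induction N) (simp_all add: T_scale algebra_simps)
  have zero: "(?S ^^ N) 0 = 0" for N
    by (induction N) (simp_all add: T_zero)
  have mono: "(?S ^^ (M + N)) x = 0" if "(?S ^^ N) x = 0" for M N x
    using that by (simp add: funpow_add zero)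
  show ?thesis
  proof (rule subspaceI)
    show "0 \<in> gen_eigenspace \<mu>" using zero unfolding gen_eigenspace_def by blast
  next
    fix x y assume "x \<in> gen_eigenspace \<mu>" "y \<in> gen_eigenspace \<mu>"
    then obtain M N where "(?S ^^ M) x = 0" "(?S ^^ N) y = 0"
      unfolding gen_eigenspace_def by blast
    then have "(?S ^^ (M + N)) (x + y) = 0"
      using mono[of M x N] mono[of N y M] by (simp add: add add.commute[of M N])
    then show "x + y \<in> gen_eigenspace \<mu>" unfolding gen_eigenspace_def by blast
  next
    fix c x assume "x \<in> gen_eigenspace \<mu>"
    then show "scale c x \<in> gen_eigenspace \<mu>"
      using scl unfolding gen_eigenspace_def by fastforce
  qed
qed

end

locale triangular_operator = complex_operator scale Basis T
  for scale :: "complex \<Rightarrow> 'v::ab_group_add \<Rightarrow> 'v" and Basis T +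
  fixes n :: nat and b :: "nat \<Rightarrow> 'v" and lam :: "nat \<Rightarrow> complex"
  assumes tri: "triangular n b lam" and spans: "span (b ` {..<n}) = UNIV"
begin

definition coord :: "'v \<Rightarrow> nat \<Rightarrow> complex" where
  "coord v i = representation (b ` {..<n}) v (b i)"

lemma b: "inj_on b {..<n}" "independent (b ` {..<n})"
  using tri unfolding triangular_def by blast+

lemma coord_linear:
  "coord (x + y) i = coord x i + coord y i" "coord (x - y) i = coord x i - coord y i"
  "coord (scale c x) i = c * coord x i" "coord (sum f A) i = (\<Sum>j\<in>A. coord (f j) i)"
  "coord 0 i = 0"
  using b(2) spans unfolding coord_def
  by (simp_all add: representation_add representation_diff representation_scale
      representation_sum representation_zero)

lemma coord_expansion: "v = (\<Sum>i<n. scale (coord v i) (b i))"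
  using sum_representation_eq[of "b ` {..<n}" v "b ` {..<n}"] b spans
  by (simp add: coord_def sum.reindex)

lemma coord_b: "i < n \<Longrightarrow> k < n \<Longrightarrow> coord (b k) i = (if i = k then 1 else 0)"
  using representation_basis[of "b ` {..<n}" "b k"] b inj_onD[OF b(1), of k i]
  unfolding coord_def by auto

lemma coord_outside:
  assumes "v \<in> span (b ` I)" "I \<subseteq> {..<n}" "i < n" "i \<notin> I"
  shows "coord v i = 0"
  using assms(1)
proof (induction rule: span_induct_alt)
  case base
  then show ?case by (simp add: coord_linear)
next
  case (step c x y)
  then obtain j where "x = b j" "j \<in> I" "j < n" "j \<noteq> i" using assms by blast
  with step assms(3) show ?case by (simp add: coord_linear coord_b)
qed

lemma coord_T:
  assumes "i < n" "k < n" "\<not> (i < k \<and> lam i = lam k)"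
  shows "coord (T (b k)) i = (if i = k then lam k else 0)"
proof -
  have "T (b k) - scale (lam k) (b k) \<in> span (b ` {j. j < k \<and> lam j = lam k})"
    using tri assms unfolding triangular_def by blast
  then have "coord (T (b k) - scale (lam k) (b k)) i = 0"
    using assms by (intro coord_outside[of _ "{j. j < k \<and> lam j = lam k}"]) auto
  then show ?thesis using assms by (auto simp: coord_linear coord_b)
qed

lemma b_in_gen_eigenspace: "i < n \<Longrightarrow> b i \<in> gen_eigenspace (lam i)"
proof (induction i rule: less_induct)
  case (less i)
  have "b ` {j. j < i \<and> lam j = lam i} \<subseteq> gen_eigenspace (lam i)"
    using less by (auto, metis less_trans)
  then have "span (b ` {j. j < i \<and> lam j = lam i}) \<subseteq> gen_eigenspace (lam i)"
    by (rule span_minimal) (rule subspace_gen_eigenspace)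
  then show ?case
    using tri less.prems gen_eigenspace_step unfolding triangular_def by blast
qed

text \<open>On the sum of the other generalized eigenspaces \<open>T - \<mu>\<close> is triangular with nonzero diagonal
  \<open>lam i - \<mu>\<close>, hence injective.\<close>

lemma coord_gen_eigenspace:
  assumes "v \<in> gen_eigenspace \<mu>" "i < n" "lam i \<noteq> \<mu>"
  shows "coord v i = 0"
proof -
  let ?S = "\<lambda>v. T v - scale \<mu> v"
  have step: "coord v i = 0" if Sv: "\<And>i. i < n \<Longrightarrow> lam i \<noteq> \<mu> \<Longrightarrow> coord (?S v) i = 0"
    and "i < n" "lam i \<noteq> \<mu>" for v i
    using that(2,3)
  proof (induction "n - i" arbitrary: i rule: less_induct)
    case less
    have "coord (T v) i = (\<Sum>k<n. coord v k * coord (T (b k)) i)"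
      by (subst coord_expansion[of v]) (simp add: T_sum T_scale coord_linear)
    also have "\<dots> = (\<Sum>k<n. if k = i then coord v i * lam i else 0)"
    proof (rule sum.cong)
      fix k assume k: "k \<in> {..<n}"
      show "coord v k * coord (T (b k)) i = (if k = i then coord v i * lam i else 0)"
      proof (cases "i < k \<and> lam i = lam k")
        case True
        then have "coord v k = 0" using less(1)[of k] less.prems k by (simp add: diff_less_mono2)
        then show ?thesis using True by simp
      next
        case False
        then show ?thesis using less.prems k by (simp add: coord_T)
      qed
    qed simp
    finally have "coord (?S v) i = coord v i * (lam i - \<mu>)"
      using less.prems by (simp add: coord_linear algebra_simps)
    then show ?case using Sv[of i] less.prems by simp
  qed
  obtain N where "(?S ^^ N) v = 0" using assms(1) unfolding gen_eigenspace_def by blast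
  then have "\<forall>i<n. lam i \<noteq> \<mu> \<longrightarrow> coord v i = 0"
  proof (induction N arbitrary: v)
    case 0
    then show ?case by (simp add: coord_linear)
  next
    case (Suc N)
    then have "(?S ^^ N) (?S v) = 0" unfolding funpow_Suc_right o_apply by blast
    then show ?case using Suc.IH step by blast
  qed
  then show ?thesis using assms by blast
qed

text \<open>The semisimple part of \<open>T\<close> with its eigenvalues replaced by their complex conjugates.\<close>

definition D :: "'v \<Rightarrow> 'v" where
  "D v = (\<Sum>i<n. scale (coord v i * cnj (lam i)) (b i))"

lemma D_add: "D (x + y) = D x + D y"
  and D_scale: "D (scale c x) = scale c (D x)"
  by (simp_all add: D_def coord_linear sum.distrib scale_left_distrib scale_sum_right algebra_simps)

lemma D_gen_eigenspace:
  assumes "v \<in> gen_eigenspace \<mu>"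
  shows "D v = scale (cnj \<mu>) v"
proof -
  have "scale (coord v i * cnj (lam i)) (b i) = scale (cnj \<mu>) (scale (coord v i) (b i))"
    if "i < n" for i
    using coord_gen_eigenspace[OF assms that] by (cases "lam i = \<mu>") (simp_all add: mult.commute)
  then have "D v = scale (cnj \<mu>) (\<Sum>i<n. scale (coord v i) (b i))"
    unfolding D_def scale_sum_right by (intro sum.cong) auto
  then show ?thesis using coord_expansion[of v] by simp
qed

lemma D_b: "i < n \<Longrightarrow> D (b i) = scale (cnj (lam i)) (b i)"
  by (intro D_gen_eigenspace b_in_gen_eigenspace)

lemma diagonal_T_D: "i < n \<Longrightarrow> coord (T (D (b i))) i = of_real ((cmod (lam i))\<^sup>2)"
  using coord_T[of i i] complex_norm_square[of "lam i"]
  by (simp add: D_b T_scale coord_linear mult.commute)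

lemma nilpotent_if_eigenvalues_zero:
  assumes "\<And>i. i < n \<Longrightarrow> lam i = 0"
  shows "\<exists>m. (T ^^ m) v = 0"
proof -
  have "b ` {..<n} \<subseteq> gen_eigenspace 0" using b_in_gen_eigenspace assms by fastforce
  then have "span (b ` {..<n}) \<subseteq> gen_eigenspace 0"
    by (rule span_minimal) (rule subspace_gen_eigenspace)
  then have "v \<in> gen_eigenspace 0" using spans by blast
  then show ?thesis by (simp add: gen_eigenspace_def)
qed

end

section \<open>The radical of the Killing form\<close>

context lie_algebra
begin

definition killing_radical :: "'g set" where
  "killing_radical = {x. \<forall>y. killing x y = 0}"

lemma subspace_killing_radical: "subspace killing_radical"
  using killing_scale_left[of 0 0]
  by (auto intro!: subspaceI simp: killing_radical_def killing_add_left killing_scale_left)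

lemma ideal_killing_radical: "ideal killing_radical"
proof -
  have "killing (bracket x y) z = 0" if "y \<in> killing_radical" for x y z
    using killing_scale_left[of "- 1" "bracket y x" z] that
    by (simp add: bracket_swap[of x y] killing_invariant killing_radical_def)
  then show ?thesis
    using subspace_killing_radical unfolding ideal_def killing_radical_def by blast
qed

abbreviation derived :: "'g set \<Rightarrow> 'g set" where
  "derived I \<equiv> span {bracket x y | x y. x \<in> I \<and> y \<in> I}"

text \<open>The commutator of a derivation \<open>D\<close> with \<open>Ad z\<close> is \<open>Ad (D z)\<close>.  By cyclicity the trace of
  \<open>Ad [y, z] \<circ> D\<close> is therefore \<open>- \<beta>(y, D z)\<close>, which vanishes for \<open>y\<close> in the radical of \<open>\<beta>\<close>.\<close>

lemma trace_Ad_derivation_zero: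
  assumes D: "lin D" "\<And>y z. D (bracket y z) = bracket (D y) z + bracket y (D z)"
    and x: "x \<in> derived killing_radical"
  shows "trace (Ad x \<circ> D) = 0"
  using x
proof (induction rule: span_induct_alt)
  case base
  show ?case using trace_scale[of 0 "\<lambda>v. 0"] by (simp add: o_def)
next
  case (step c u w)
  then obtain y z where u: "u = bracket y z" and y: "y \<in> killing_radical" by blast
  have "trace (Ad u \<circ> D) = trace (\<lambda>v. Ad y (Ad z (D v)) - Ad z (Ad y (D v)))"
    by (simp add: u o_def Ad_bracket)
  also have "\<dots> = trace (\<lambda>v. Ad y (Ad z (D v) - D (Ad z v)))"
    using D(1) by (intro trace_commutator_swap linear_bracket_right)
  also have "\<dots> = trace (\<lambda>v. scale (- 1) (Ad y (Ad (D z) v)))"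
    by (simp add: D(2) bracket_minus_right)
  also have "\<dots> = - killing y (D z)"
    unfolding trace_scale by (simp add: killing_def o_def)
  also have "\<dots> = 0" using y by (simp add: killing_radical_def)
  finally have "trace (\<lambda>v. Ad u (D v)) = 0" by (simp add: o_def)
  with step show ?case
    by (simp add: o_def bracket_add_left bracket_scale_left trace_add trace_scale)
qed

end

locale complex_lie_algebra = lie_algebra scale bracket
  for scale :: "complex \<Rightarrow> 'g::ab_group_add \<Rightarrow> 'g" and bracket
begin

text \<open>Let \<open>D\<close> act on the generalized eigenspace of \<open>Ad x\<close> with eigenvalue \<open>\<lambda>\<close> as the scalar
  \<open>cnj \<lambda>\<close>.  Since these spaces grade the Lie algebra and conjugation is additive, \<open>D\<close> is a
  derivation.  Hence the trace of \<open>Ad x \<circ> D\<close> vanishes; but it is the sum of the \<open>\<bar>\<lambda>\<bar>\<^sup>2\<close> over all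
  eigenvalues with multiplicity, so all eigenvalues are zero.\<close>

theorem Ad_nilpotent:
  assumes x: "x \<in> derived killing_radical"
  shows "\<exists>m. (Ad x ^^ m) v = 0"
proof -
  interpret T: complex_operator scale basis "Ad x"
    by unfold_locales (simp_all add: bracket_add_right bracket_scale_right)
  obtain n b lam where tri: "T.triangular n b lam" "span (b ` {..<n}) = UNIV"
    using T.triangular_exists by blast
  interpret T: triangular_operator scale basis "Ad x" n b lam
    by unfold_locales (fact tri)+
  have grading: "bracket y z \<in> T.gen_eigenspace (\<mu> + \<nu>)"
    if "((\<lambda>v. Ad x v - scale \<mu> v) ^^ M) y = 0" "((\<lambda>v. Ad x v - scale \<nu> v) ^^ N) z = 0" for \<mu> \<nu> M N y z
    using that
  proof (induction "M + N" arbitrary: M N y z rule: less_induct)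
    case less
    show ?case
    proof (cases "M = 0 \<or> N = 0")
      case True
      then show ?thesis
        using less.prems subspace_0[OF T.subspace_gen_eigenspace] by auto
    next
      case False
      then obtain M' N' where MN: "M = Suc M'" "N = Suc N'" by (meson not0_implies_Suc)
      have "bracket (Ad x y - scale \<mu> y) z \<in> T.gen_eigenspace (\<mu> + \<nu>)"
        using less.prems MN by (intro less.hyps[of M' N]) (simp_all del: funpow.simps add: funpow_Suc_right)
      moreover have "bracket y (Ad x z - scale \<nu> z) \<in> T.gen_eigenspace (\<mu> + \<nu>)"
        using less.prems MN by (intro less.hyps[of M N']) (simp_all del: funpow.simps add: funpow_Suc_right)
      ultimately have "bracket (Ad x y - scale \<mu> y) z + bracket y (Ad x z - scale \<nu> z)
          \<in> T.gen_eigenspace (\<mu> + \<nu>)"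
        by (rule subspace_add[OF T.subspace_gen_eigenspace])
      also have "bracket (Ad x y - scale \<mu> y) z + bracket y (Ad x z - scale \<nu> z)
          = Ad x (bracket y z) - scale (\<mu> + \<nu>) (bracket y z)"
        unfolding Ad_derivation[of x y z] bracket_diff_left bracket_diff_right
          bracket_scale_left bracket_scale_right scale_left_distrib
        by simp
      finally show ?thesis unfolding T.gen_eigenspace_step .
    qed
  qed
  have D_lin: "lin T.D" by (rule linI) (simp_all add: T.D_add T.D_scale)
  have D_b: "T.D (bracket (b i) (b j)) = bracket (T.D (b i)) (b j) + bracket (b i) (T.D (b j))"
    if "i < n" "j < n" for i j
  proof -
    have "bracket (b i) (b j) \<in> T.gen_eigenspace (lam i + lam j)"
      using T.b_in_gen_eigenspace that grading unfolding T.gen_eigenspace_def[of "lam _"] by blast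
    then have "T.D (bracket (b i) (b j)) = scale (cnj (lam i + lam j)) (bracket (b i) (b j))"
      by (rule T.D_gen_eigenspace)
    then show ?thesis
      using that by (simp add: T.D_b bracket_scale_left bracket_scale_right scale_left_distrib)
  qed
  have D_left: "T.D (bracket y (b j)) = bracket (T.D y) (b j) + bracket y (T.D (b j))" if "j < n" for y j
  proof -
    have "y \<in> span (b ` {..<n})" using tri(2) by blast
    then show ?thesis
    proof (induction rule: span_induct_alt)
      case base
      then show ?case using lin_zero[OF D_lin] by simp
    next
      case (step c u w)
      then show ?case using D_b that
        by (auto simp: T.D_add T.D_scale bracket_add_left bracket_scale_left scale_right_distrib)
    qed
  qed
  have D: "T.D (bracket y z) = bracket (T.D y) z + bracket y (T.D z)" for y z
  proof -
    have "z \<in> span (b ` {..<n})" using tri(2) by blast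
    then show ?thesis
    proof (induction rule: span_induct_alt)
      case base
      then show ?case using lin_zero[OF D_lin] by simp
    next
      case (step c u w)
      then show ?case using D_left
        by (auto simp: T.D_add T.D_scale bracket_add_right bracket_scale_right scale_right_distrib)
    qed
  qed
  have "trace (Ad x \<circ> T.D) = (\<Sum>u\<in>b ` {..<n}. representation (b ` {..<n}) ((Ad x \<circ> T.D) u) u)"
    by (rule trace_eq) (use T.b tri(2) D_lin in \<open>auto intro!: lin_compose linear_bracket_right\<close>)
  also have "\<dots> = (\<Sum>i<n. T.coord (Ad x (T.D (b i))) i)"
    by (simp add: sum.reindex[OF T.b(1)] T.coord_def)
  also have "\<dots> = of_real (\<Sum>i<n. (cmod (lam i))\<^sup>2)"
    by (simp add: T.diagonal_T_D)
  finally have "(\<Sum>i<n. (cmod (lam i))\<^sup>2) = 0"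
    using trace_Ad_derivation_zero[OF D_lin D x] by (metis of_real_eq_0_iff)
  then have "lam i = 0" if "i < n" for i
    using that by (subst (asm) sum_nonneg_eq_0_iff) auto
  then show ?thesis by (rule T.nilpotent_if_eigenvalues_zero)
qed

end

section \<open>Complexification\<close>

locale real_lie_algebra = lie_algebra scale bracket
  for scale :: "real \<Rightarrow> 'g::ab_group_add \<Rightarrow> 'g" and bracket
begin

text \<open>The pair \<open>(x, y)\<close> stands for \<open>x + i y\<close>.\<close>

definition cscale :: "complex \<Rightarrow> 'g \<times> 'g \<Rightarrow> 'g \<times> 'g" where
  "cscale z p = (scale (Re z) (fst p) - scale (Im z) (snd p), scale (Re z) (snd p) + scale (Im z) (fst p))"

definition cbracket :: "'g \<times> 'g \<Rightarrow> 'g \<times> 'g \<Rightarrow> 'g \<times> 'g" where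
  "cbracket p q = (bracket (fst p) (fst q) - bracket (snd p) (snd q),
     bracket (fst p) (snd q) + bracket (snd p) (fst q))"

lemma vector_space_cscale: "vector_space cscale"
  by unfold_locales
    (auto simp: cscale_def scale_right_distrib scale_right_diff_distrib scale_left_distrib
      scale_left_diff_distrib prod_eq_iff algebra_simps)

definition cbasis :: "('g \<times> 'g) set" where
  "cbasis = (\<lambda>b. (b, 0)) ` basis"

lemma cbasis_expansion:
  "(x, y) = (\<Sum>b\<in>basis. cscale (Complex (representation basis x b) (representation basis y b)) (b, 0))"
  using basis_expansion[of x] basis_expansion[of y]
  by (simp add: prod_eq_iff fst_sum snd_sum cscale_def)

lemma complexification: "complex_lie_algebra cscale cbracket"
proof -
  interpret C: vector_space cscale by (rule vector_space_cscale)
  have "C.span cbasis = UNIV"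
  proof -
    have "(x, y) \<in> C.span cbasis" for x y
      unfolding cbasis_expansion[of x y]
      by (intro C.span_sum C.span_scale C.span_base) (auto simp: cbasis_def)
    then show ?thesis by auto
  qed
  moreover have "finite cbasis" using finite_Basis by (simp add: cbasis_def)
  moreover have lin: "Vector_Spaces.linear cscale cscale (\<lambda>x. cbracket x y)"
      "Vector_Spaces.linear cscale cscale (\<lambda>x. cbracket y x)" for y
    unfolding Vector_Spaces.linear_iff
    by (auto simp: vector_space_cscale prod_eq_iff cbracket_def cscale_def
        bracket_add_left bracket_add_right bracket_diff_left bracket_diff_right
        bracket_scale_left bracket_scale_right scale_right_distrib scale_right_diff_distrib algebra_simps)
  moreover have "cbracket p p = 0" for p
    using bracket_swap[of "fst p" "snd p"] by (simp add: cbracket_def prod_eq_iff bracket_self)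
  moreover have "cbracket p (cbracket q r) + cbracket q (cbracket r p) + cbracket r (cbracket p q) = 0" for p q r
  proof -
    obtain x x' y y' z z' where [simp]: "p = (x, x')" "q = (y, y')" "r = (z, z')"
      by (metis surj_pair)
    define J where "J u v w = bracket u (bracket v w) + bracket v (bracket w u) + bracket w (bracket u v)"
      for u v w
    let ?L = "cbracket p (cbracket q r) + cbracket q (cbracket r p) + cbracket r (cbracket p q)"
    have "fst ?L = J x y z - J x y' z' - J x' y z' - J x' y' z"
      by (simp add: cbracket_def J_def bracket_add_right bracket_diff_right algebra_simps)
    moreover have "snd ?L = J x' y z + J x y' z + J x y z' - J x' y' z'"
      by (simp add: cbracket_def J_def bracket_add_right bracket_diff_right algebra_simps)
    ultimately show ?thesis by (simp add: prod_eq_iff J_def jacobi)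
  qed
  ultimately show ?thesis
    by (intro complex_lie_algebra.intro lie_algebra.intro lie_algebra_axioms.intro vector_space_cscale)
      blast+
qed

sublocale C: complex_lie_algebra cscale cbracket
  by (rule complexification)

lemma cbasis: "C.independent cbasis" "C.span cbasis = UNIV" "finite cbasis"
proof -
  show fin: "finite cbasis" using finite_Basis by (simp add: cbasis_def)
  have "(x, y) \<in> C.span cbasis" for x y
    unfolding cbasis_expansion[of x y]
    by (intro C.span_sum C.span_scale C.span_base) (auto simp: cbasis_def)
  then show "C.span cbasis = UNIV" by auto
  show "C.independent cbasis"
  proof (rule C.independent_if_scalars_zero[OF fin])
    fix f p assume 0: "(\<Sum>q\<in>cbasis. cscale (f q) q) = 0" and p: "p \<in> cbasis"
    then obtain b where b: "b \<in> basis" "p = (b, 0)" by (auto simp: cbasis_def)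
    have "(\<Sum>q\<in>cbasis. cscale (f q) q) = (\<Sum>b\<in>basis. cscale (f (b, 0)) (b, 0))"
      unfolding cbasis_def by (subst sum.reindex) (auto simp: inj_on_def)
    then have "(\<Sum>b\<in>basis. scale (Re (f (b, 0))) b) = 0" "(\<Sum>b\<in>basis. scale (Im (f (b, 0))) b) = 0"
      using 0 by (simp_all add: prod_eq_iff fst_sum snd_sum cscale_def)
    then have "Re (f (b, 0)) = 0" "Im (f (b, 0)) = 0"
      using independentD[OF independent_Basis finite_Basis subset_refl _ b(1), of "\<lambda>b. Re (f (b, 0))"]
        independentD[OF independent_Basis finite_Basis subset_refl _ b(1), of "\<lambda>b. Im (f (b, 0))"]
      by auto
    then show "f p = 0" by (simp add: b complex_eq_iff)
  qed
qed

text \<open>A real operator extended to the complexification has the same matrix in the basis of real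
  vectors.\<close>

lemma trace_complexified:
  assumes A: "lin A" and A': "C.lin (map_prod A A)"
  shows "C.trace (map_prod A A) = of_real (trace A)"
proof -
  have rep: "C.representation cbasis (x, 0) (b, 0) = of_real (representation basis x b)" if "b \<in> basis" for x b
  proof -
    have delta: "C.representation cbasis (c, 0) (b, 0) = (if b = c then 1 else 0)" if "c \<in> basis" for c
    proof -
      have "(c, 0) \<in> cbasis" using that by (simp add: cbasis_def)
      from C.representation_basis[OF cbasis(1) this] show ?thesis by auto
    qed
    have "C.representation cbasis (x, 0) (b, 0)
        = C.representation cbasis (\<Sum>c\<in>basis. cscale (Complex (representation basis x c) 0) (c, 0)) (b, 0)"
      by (subst cbasis_expansion) (simp add: representation_zero)
    also have "\<dots> = (\<Sum>c\<in>basis. Complex (representation basis x c) 0 * C.representation cbasis (c, 0) (b, 0))"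
      using cbasis(1,2) by (simp add: C.representation_sum C.representation_scale)
    also have "\<dots> = (\<Sum>c\<in>basis. if c = b then of_real (representation basis x b) else 0)"
      by (intro sum.cong) (auto simp: delta complex_eq_iff)
    also have "\<dots> = of_real (representation basis x b)"
      using that finite_Basis by simp
    finally show ?thesis .
  qed
  have "C.trace (map_prod A A) = (\<Sum>p\<in>cbasis. C.representation cbasis (map_prod A A p) p)"
    by (rule C.trace_eq[OF A' cbasis(1,2)])
  also have "\<dots> = (\<Sum>b\<in>basis. C.representation cbasis (A b, 0) (b, 0))"
    unfolding cbasis_def by (subst sum.reindex) (auto simp: inj_on_def lin_zero[OF A])
  also have "\<dots> = of_real (trace A)"
    by (simp add: rep trace_def)
  finally show ?thesis .
qed

lemma cbracket_real: "cbracket (x, 0) = map_prod (Ad x) (Ad x)"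
  by (auto simp: cbracket_def)

lemma killing_radical_complexified:
  assumes "x \<in> killing_radical"
  shows "(x, 0) \<in> C.killing_radical"
proof -
  have real: "C.killing (x, 0) (y, 0) = 0" for y
  proof -
    have "C.lin (map_prod (Ad x \<circ> Ad y) (Ad x \<circ> Ad y))"
      using C.lin_compose[OF C.linear_bracket_right C.linear_bracket_right, of "(x, 0)" "(y, 0)"]
      by (simp add: cbracket_real map_prod_compose)
    then show ?thesis
      using trace_complexified[of "Ad x \<circ> Ad y"] assms
      by (simp add: C.killing_def cbracket_real map_prod_compose lin_compose linear_bracket_right
          killing_radical_def killing_def)
  qed
  have "C.killing (x, 0) (y, z) = 0" for y z
  proof -
    have "(y, z) = (y, 0) + cscale \<i> (z, 0)" by (simp add: cscale_def)
    then show ?thesis by (simp only: C.killing_add_right C.killing_scale_right real) simp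
  qed
  then show ?thesis by (auto simp: C.killing_radical_def)
qed

text \<open>Nilpotency descends from the complexification, where elements of the radical of the real
  Killing form stay in the radical.\<close>

theorem Ad_nilpotent:
  assumes x: "x \<in> derived killing_radical"
  shows "\<exists>m. (Ad x ^^ m) v = 0"
proof -
  have "(x, 0) \<in> C.derived C.killing_radical"
    using x
  proof (induction rule: span_induct_alt)
    case base
    then show ?case using C.span_zero by (simp add: zero_prod_def)
  next
    case (step c u w)
    then obtain y z where u: "u = bracket y z" "y \<in> killing_radical" "z \<in> killing_radical" by blast
    then have "(u, 0) = cbracket (y, 0) (z, 0)" by (simp add: cbracket_def)
    then have "(u, 0) \<in> C.derived C.killing_radical"
      using u killing_radical_complexified by (intro C.span_base) blast
    then have "cscale (of_real c) (u, 0) + (w, 0) \<in> C.derived C.killing_radical"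
      using step by (intro C.span_add C.span_scale)
    moreover have "cscale (of_real c) (u, 0) + (w, 0) = (scale c u + w, 0)"
      by (simp add: cscale_def)
    ultimately show ?case by (simp only:)
  qed
  then obtain m where "(cbracket (x, 0) ^^ m) (v, 0) = 0" using C.Ad_nilpotent by blast
  moreover have "(cbracket (x, 0) ^^ m) (v, 0) = ((Ad x ^^ m) v, 0)"
    by (induction m) (simp_all add: cbracket_real)
  ultimately show ?thesis by (auto simp: zero_prod_def)
qed

end

section \<open>Cartan's criterion\<close>

context semisimple_lie_algebra
begin

text \<open>The derived series of the radical of the Killing form ends in a perfect subalgebra.  Its
  elements are sums of brackets of radical elements, hence ad-nilpotent, so that Engel's theorem
  makes it zero.  The radical is thus a solvable ideal.\<close>

theorem killing_radical_zero:
  assumes nil: "\<And>x v. x \<in> derived killing_radical \<Longrightarrow> \<exists>m. (Ad x ^^ m) v = 0"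
  shows "killing_radical = {0}"
proof -
  let ?R = "killing_radical"
  define S where "S = derived_series ?R"
  have mono: "derived I \<subseteq> derived J" if "I \<subseteq> J" for I J
    using that by (intro span_mono) blast
  have S: "subspace (S n)" for n
    using subspace_killing_radical by (cases n) (simp_all add: S_def)
  have S_Suc: "S (Suc n) = derived (S n)" for n
    by (simp add: S_def)
  have dec: "S (Suc n) \<subseteq> S n" for n
  proof (induction n)
    case 0
    show ?case unfolding S_Suc
      by (rule span_minimal) (use ideal_killing_radical in \<open>auto simp: S_def ideal_def\<close>)
  next
    case (Suc n)
    show ?case unfolding S_Suc[of "Suc n"] S_Suc[of n] using Suc by (intro mono) (simp add: S_Suc)
  qed
  have sub: "S n \<subseteq> ?R" for n
  proof (induction n)
    case (Suc n)
    then show ?case using dec[of n] by blast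
  qed (simp add: S_def)
  \<comment> \<open>the series is stationary from a term of least dimension on\<close>
  define n where "n = (ARG_MIN (\<lambda>n. dim (S n)) n. True)"
  have "dim (S n) \<le> dim (S (Suc n))"
    unfolding n_def by (rule arg_min_nat_le) simp
  then have eq: "S (Suc n) = S n"
    using subspace_dim_equal[OF S S dec] by blast
  have "S n = {0}"
  proof (rule perfect_Ad_nilpotent_imp_zero[OF S])
    show "derived (S n) = S n" using eq S_Suc by simp
    fix x v assume "x \<in> S n"
    then have "x \<in> derived ?R" using eq S_Suc mono[OF sub[of n]] by blast
    then show "\<exists>m. (Ad x ^^ m) v = 0" by (rule nil)
  qed
  then have "solvable ?R" unfolding solvable_def S_def by blast
  then show ?thesis by (rule solvable_ideal_zero[OF ideal_killing_radical])
qed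

end

section \<open>Bilinear and quadrilinear forms\<close>

context lie_algebra
begin

lemma dual_add: "\<xi> \<in> dual_space \<Longrightarrow> \<xi> (x + y) = \<xi> x + \<xi> y"
  and dual_scale: "\<xi> \<in> dual_space \<Longrightarrow> \<xi> (scale c x) = c * \<xi> x"
  unfolding dual_space_iff by blast+

lemma dual_zero: "\<xi> \<in> dual_space \<Longrightarrow> \<xi> 0 = 0"
  and dual_minus: "\<xi> \<in> dual_space \<Longrightarrow> \<xi> (- x) = - \<xi> x"
  using dual_scale[of \<xi> 0 0] dual_scale[of \<xi> "- 1" x] by simp_all

lemma dual_sum:
  assumes "\<xi> \<in> dual_space"
  shows "\<xi> (sum f A) = (\<Sum>i\<in>A. \<xi> (f i))"
  by (induction A rule: infinite_finite_induct)
    (simp_all add: dual_zero[OF assms] dual_add[OF assms])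

lemmas killing_sum_right = dual_sum[OF killing_dual]
  and killing_minus_right = dual_minus[OF killing_dual]

lemma killing_sum_left: "killing (sum f A) x = (\<Sum>i\<in>A. killing (f i) x)"
  and killing_minus_left: "killing (- y) x = - killing y x"
  unfolding killing_commute[of _ x] by (rule killing_sum_right killing_minus_right)+

lemma bilinear_left: "\<sigma> \<in> bilinear_forms \<Longrightarrow> (\<lambda>x. \<sigma> x y) \<in> dual_space"
  and bilinear_right: "\<sigma> \<in> bilinear_forms \<Longrightarrow> (\<lambda>y. \<sigma> x y) \<in> dual_space"
  unfolding bilinear_forms_def by blast+

lemmas bilinear_sum_left = dual_sum[OF bilinear_left]
  and bilinear_sum_right = dual_sum[OF bilinear_right]
  and bilinear_add_left = dual_add[OF bilinear_left]
  and bilinear_add_right = dual_add[OF bilinear_right]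
  and bilinear_scale_left = dual_scale[OF bilinear_left]
  and bilinear_scale_right = dual_scale[OF bilinear_right]
  and bilinear_minus_left = dual_minus[OF bilinear_left]
  and bilinear_minus_right = dual_minus[OF bilinear_right]

lemma bilinear_zero_left: "\<sigma> \<in> bilinear_forms \<Longrightarrow> \<sigma> 0 y = 0"
  and bilinear_zero_right: "\<sigma> \<in> bilinear_forms \<Longrightarrow> \<sigma> x 0 = 0"
  using dual_zero[OF bilinear_left] dual_zero[OF bilinear_right] by blast+

lemma dual_compose: "\<xi> \<in> dual_space \<Longrightarrow> lin f \<Longrightarrow> (\<lambda>x. \<xi> (f x)) \<in> dual_space"
  by (simp add: dual_space_iff lin_add[of f] lin_scale[of f])

lemma bilinear_compose:
  assumes \<sigma>: "\<sigma> \<in> bilinear_forms" and "lin f" "lin g"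
  shows "(\<lambda>x y. \<sigma> (f x) (g y)) \<in> bilinear_forms"
  unfolding bilinear_forms_def
  using dual_compose[OF bilinear_left[OF \<sigma>] \<open>lin f\<close>] dual_compose[OF bilinear_right[OF \<sigma>] \<open>lin g\<close>]
  by blast

lemma dual_combine: "\<xi> \<in> dual_space \<Longrightarrow> \<eta> \<in> dual_space \<Longrightarrow> (\<lambda>x. s * \<xi> x + t * \<eta> x) \<in> dual_space"
  by (simp add: dual_space_iff algebra_simps)

lemma dual_sum_closed: "(\<And>i. i \<in> A \<Longrightarrow> f i \<in> dual_space) \<Longrightarrow> (\<lambda>x. \<Sum>i\<in>A. f i x) \<in> dual_space"
  by (auto simp: dual_space_iff sum.distrib sum_distrib_left)

lemma bilinear_combine:
  "\<sigma> \<in> bilinear_forms \<Longrightarrow> \<tau> \<in> bilinear_forms \<Longrightarrow> (\<lambda>x y. s * \<sigma> x y + t * \<tau> x y) \<in> bilinear_forms"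
  unfolding bilinear_forms_def by (simp add: dual_combine)

lemma bilinear_sum_closed:
  "(\<And>i. i \<in> A \<Longrightarrow> f i \<in> bilinear_forms) \<Longrightarrow> (\<lambda>x y. \<Sum>i\<in>A. f i x y) \<in> bilinear_forms"
  unfolding bilinear_forms_def by (simp add: dual_sum_closed)

lemma quadrilinear_slots:
  assumes "\<phi> \<in> quadrilinear_forms"
  shows "(\<lambda>a. \<phi> a b c d) \<in> dual_space" "(\<lambda>b. \<phi> a b c d) \<in> dual_space"
    "(\<lambda>c. \<phi> a b c d) \<in> dual_space" "(\<lambda>d. \<phi> a b c d) \<in> dual_space"
  using assms unfolding quadrilinear_forms_def by blast+

lemma quadrilinear_combine:
  "\<phi> \<in> quadrilinear_forms \<Longrightarrow> \<psi> \<in> quadrilinear_forms \<Longrightarrow>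
    (\<lambda>a b c d. s * \<phi> a b c d + t * \<psi> a b c d) \<in> quadrilinear_forms"
  unfolding quadrilinear_forms_def by (simp add: dual_combine)

lemma quadrilinear_sum_closed:
  "(\<And>i. i \<in> A \<Longrightarrow> f i \<in> quadrilinear_forms) \<Longrightarrow>
    (\<lambda>a b c d. \<Sum>i\<in>A. f i a b c d) \<in> quadrilinear_forms"
  unfolding quadrilinear_forms_def by (simp add: dual_sum_closed)

lemma quadrilinear_tensor4:
  "\<xi> \<in> dual_space \<Longrightarrow> \<xi>' \<in> dual_space \<Longrightarrow> \<eta> \<in> dual_space \<Longrightarrow> \<eta>' \<in> dual_space \<Longrightarrow>
    tensor4 \<xi> \<xi>' \<eta> \<eta>' \<in> quadrilinear_forms"
  by (simp add: quadrilinear_forms_def tensor4_def dual_space_iff algebra_simps)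

lemma Lambda_exterior:
  assumes "\<sigma> \<in> symmetric_forms"
  shows "Lambda \<sigma> \<in> exterior_4_forms"
proof -
  have \<sigma>: "\<sigma> \<in> bilinear_forms" and sym: "\<sigma> x y = \<sigma> y x" for x y
    using assms unfolding symmetric_forms_def by auto
  have "Lambda \<sigma> \<in> quadrilinear_forms"
    using assms
    by (simp add: Lambda_def quadrilinear_forms_def dual_space_iff
        bracket_add_left bracket_add_right bracket_scale_left bracket_scale_right
        bilinear_add_left[OF \<sigma>] bilinear_add_right[OF \<sigma>]
        bilinear_scale_left[OF \<sigma>] bilinear_scale_right[OF \<sigma>] algebra_simps)
  moreover have "Lambda \<sigma> a b c d = 0"
    if "a = b \<or> a = c \<or> a = d \<or> b = c \<or> b = d \<or> c = d" for a b c d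
  proof -
    note zero = bracket_self bilinear_zero_left[OF \<sigma>] bilinear_zero_right[OF \<sigma>]
      bilinear_minus_left[OF \<sigma>] bilinear_minus_right[OF \<sigma>]
    have L: "Lambda \<sigma> a b c d = \<sigma> (bracket a b) (bracket c d) + \<sigma> (bracket b c) (bracket a d)
        + \<sigma> (bracket c a) (bracket b d)"
      using assms by (simp add: Lambda_def)
    from that consider "a = b" | "a = c" | "a = d" | "b = c" | "b = d" | "c = d" by blast
    then show ?thesis
    proof cases
      case 1
      then show ?thesis unfolding L using bracket_swap[of c b] by (simp add: zero)
    next
      case 2
      then show ?thesis unfolding L using bracket_swap[of b c] by (simp add: zero)
    next
      case 3
      then show ?thesis
        unfolding L using bracket_swap[of b d] sym[of "bracket c d" "bracket d b"] by (simp add: zero)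
    next
      case 4
      then show ?thesis unfolding L using bracket_swap[of c a] by (simp add: zero)
    next
      case 5
      then show ?thesis
        unfolding L using bracket_swap[of c d] sym[of "bracket d c" "bracket a d"] by (simp add: zero)
    next
      case 6
      then show ?thesis
        unfolding L using bracket_swap[of d a] sym[of "bracket b d" "bracket a d"] by (simp add: zero)
    qed
  qed
  ultimately show ?thesis unfolding exterior_4_forms_def by blast
qed

end

section \<open>Contraction with a nondegenerate Killing form\<close>

locale nondegenerate_lie_algebra = lie_algebra scale bracket
  for scale :: "'f::field \<Rightarrow> 'g::ab_group_add \<Rightarrow> 'g" and bracket +
  assumes nondegenerate: "(\<And>y. killing x y = 0) \<Longrightarrow> x = 0"
begin

lemma killing_eqI:
  assumes "\<And>v. killing x v = killing y v"
  shows "x = y"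
proof -
  have "killing (x + scale (- 1) y) v = 0" for v
    unfolding killing_add_left killing_scale_left assms by simp
  from nondegenerate[OF this] show ?thesis by simp
qed

lemma dual_eqI:
  assumes "\<xi> \<in> dual_space" "\<eta> \<in> dual_space" "\<And>b. b \<in> basis \<Longrightarrow> \<xi> b = \<eta> b"
  shows "\<xi> = \<eta>"
proof
  fix v
  show "\<xi> v = \<eta> v"
    by (subst (1 2) basis_expansion[of v]) (simp add: dual_sum[OF assms(1)] dual_scale[OF assms(1)]
        dual_sum[OF assms(2)] dual_scale[OF assms(2)] assms(3))
qed

lemma representation_combination:
  assumes "c \<in> basis"
  shows "representation basis (\<Sum>b\<in>basis. scale (k b) b) c = k c"
proof -
  have "representation basis (\<Sum>b\<in>basis. scale (k b) b) c = (\<Sum>b\<in>basis. if b = c then k c else 0)"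
    unfolding representation_basis_linear
    by (intro sum.cong) (auto simp: representation_basis[OF independent_Basis])
  then show ?thesis using assms finite_Basis by simp
qed

text \<open>The linear map whose coordinates are the values of \<open>killing x\<close> on the basis is injective,
  hence bijective.\<close>

lemma killing_represents:
  assumes "\<xi> \<in> dual_space"
  shows "\<exists>!x. killing x = \<xi>"
proof -
  define F where "F x = (\<Sum>b\<in>basis. scale (killing x b) b)" for x
  have "lin F"
    by (rule linI) (simp_all add: F_def killing_add_left killing_scale_left scale_left_distrib
        sum.distrib scale_sum_right)
  have F: "killing x b = representation basis (F x) b" if "b \<in> basis" for x b
    unfolding F_def by (rule representation_combination[OF that, symmetric])
  have "inj F"
  proof (rule injI)
    fix x y assume "F x = F y"
    then have "killing x = killing y"
      by (intro dual_eqI killing_dual) (simp add: F)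
    then show "x = y" by (intro killing_eqI) simp
  qed
  then have "surj F" using linear_inj_imp_surj \<open>lin F\<close> by blast
  then obtain x where "F x = (\<Sum>b\<in>basis. scale (\<xi> b) b)" by (metis surjD)
  then have "killing x = \<xi>"
    using assms by (intro dual_eqI killing_dual) (simp_all add: F representation_combination)
  then show ?thesis using killing_eqI by metis
qed

definition dual :: "'g \<Rightarrow> 'g" where
  "dual b = (THE x. killing x = (\<lambda>v. representation basis v b))"

lemma killing_dual_basis: "killing (dual b) v = representation basis v b"
proof -
  have "(\<lambda>v. representation basis v b) \<in> dual_space"
    by (simp add: dual_space_iff representation_basis_linear)
  from theI'[OF killing_represents[OF this]] show ?thesis
    unfolding dual_def by (rule fun_cong)
qed

lemma expansion: "v = (\<Sum>b\<in>basis. scale (killing (dual b) v) b)"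
  unfolding killing_dual_basis by (rule basis_expansion)

lemma dual_expansion: "v = (\<Sum>b\<in>basis. scale (killing v b) (dual b))"
proof (rule killing_eqI)
  fix w
  have "killing v w = (\<Sum>b\<in>basis. killing v b * killing (dual b) w)"
    by (subst expansion[of w]) (simp add: killing_sum_right killing_scale_right mult.commute)
  then show "killing v w = killing (\<Sum>b\<in>basis. scale (killing v b) (dual b)) w"
    by (simp add: killing_sum_left killing_scale_left)
qed

lemma contract:
  assumes "\<xi> \<in> dual_space"
  shows "(\<Sum>b\<in>basis. killing (dual b) v * \<xi> b) = \<xi> v"
    and "(\<Sum>b\<in>basis. killing v b * \<xi> (dual b)) = \<xi> v"
proof -
  show "(\<Sum>b\<in>basis. killing (dual b) v * \<xi> b) = \<xi> v"
    by (subst (2) expansion[of v]) (simp add: dual_sum[OF assms] dual_scale[OF assms])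
  show "(\<Sum>b\<in>basis. killing v b * \<xi> (dual b)) = \<xi> v"
    by (subst (2) dual_expansion[of v]) (simp add: dual_sum[OF assms] dual_scale[OF assms])
qed

lemma trace_contraction: "trace T = (\<Sum>b\<in>basis. killing (dual b) (T b))"
  by (simp add: trace_def killing_dual_basis)

text \<open>The Casimir tensor \<open>\<Sum> b \<otimes> dual b\<close> is the inverse of the Killing form, and therefore shares
  its symmetry and its invariance.\<close>

lemma casimir_swap:
  assumes f: "f \<in> bilinear_forms"
  shows "(\<Sum>b\<in>basis. f b (dual b)) = (\<Sum>b\<in>basis. f (dual b) b)"
proof -
  have "(\<Sum>b\<in>basis. f b (dual b)) = (\<Sum>b\<in>basis. \<Sum>c\<in>basis. killing b c * f (dual c) (dual b))"
    by (intro sum.cong contract(2)[symmetric] bilinear_left f refl)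
  also have "\<dots> = (\<Sum>c\<in>basis. \<Sum>b\<in>basis. killing c b * f (dual c) (dual b))"
    by (subst sum.swap) (simp add: killing_commute)
  also have "\<dots> = (\<Sum>c\<in>basis. f (dual c) c)"
    by (intro sum.cong contract(2) bilinear_right f refl)
  finally show ?thesis .
qed

lemma casimir_invariant:
  assumes f: "f \<in> bilinear_forms"
  shows "(\<Sum>b\<in>basis. f (bracket x b) (dual b)) = - (\<Sum>b\<in>basis. f b (bracket x (dual b)))"
proof -
  have swap: "killing (dual c) (bracket x b) = - killing (bracket x (dual c)) b" for b c
    unfolding killing_invariant[symmetric] bracket_swap[of "dual c" x] killing_minus_left ..
  have "(\<Sum>b\<in>basis. f (bracket x b) (dual b))
      = (\<Sum>b\<in>basis. \<Sum>c\<in>basis. killing (dual c) (bracket x b) * f c (dual b))"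
    by (intro sum.cong contract(1)[symmetric] bilinear_left f refl)
  also have "\<dots> = - (\<Sum>c\<in>basis. \<Sum>b\<in>basis. killing (bracket x (dual c)) b * f c (dual b))"
    by (subst sum.swap) (simp add: swap sum_negf)
  also have "\<dots> = - (\<Sum>c\<in>basis. f c (bracket x (dual c)))"
    by (simp add: contract(2)[OF bilinear_right[OF f]])
  finally show ?thesis .
qed

text \<open>Paired with any \<open>v\<close>, both sums turn by invariance into the contraction that computes the
  trace of \<open>Ad u \<circ> Ad v\<close>, which is \<open>\<beta>(u, v)\<close> by definition.  In other words, the Casimir
  operator of the adjoint representation is the identity.\<close>

lemma casimir_adjoint:
  "(\<Sum>b\<in>basis. bracket b (bracket (dual b) u)) = u"
  "(\<Sum>b\<in>basis. bracket (dual b) (bracket b u)) = u"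
proof -
  have cycle: "killing (bracket p (bracket q u)) v = killing q (bracket u (bracket v p))" for p q v
    unfolding bracket_swap[of p "bracket q u"] bracket_swap[of v p] bracket_minus_right
      killing_minus_left killing_minus_right killing_invariant ..
  have killing: "killing \<in> bilinear_forms"
    by (simp add: bilinear_forms_def dual_space_iff killing_add_left killing_scale_left
        killing_add_right killing_scale_right)
  have f: "(\<lambda>p q. killing p (bracket u (bracket v q))) \<in> bilinear_forms" for v
    by (intro bilinear_compose[OF killing] lin_intros)
  have "(\<Sum>b\<in>basis. killing (dual b) (bracket u (bracket v b))) = killing u v" for v
    by (simp add: killing_def[of u v] trace_contraction)
  then show "(\<Sum>b\<in>basis. bracket b (bracket (dual b) u)) = u"
      "(\<Sum>b\<in>basis. bracket (dual b) (bracket b u)) = u"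
    by (intro killing_eqI; simp add: killing_sum_left cycle casimir_swap[OF f])+
qed

text \<open>On symmetric forms this operator is \<open>- \<Omega> / 2\<close>.  As a formula in \<open>\<sigma>\<close> itself, without the
  operator \<open>\<Sigma>\<close> that represents \<open>\<sigma>\<close>, it is easy to iterate.\<close>

definition casimir_op :: "('g \<Rightarrow> 'g \<Rightarrow> 'f) \<Rightarrow> 'g \<Rightarrow> 'g \<Rightarrow> 'f" where
  "casimir_op \<sigma> x y = (\<Sum>b\<in>basis. \<sigma> (bracket b x) (bracket (dual b) y))"

lemma casimir_op_bilinear:
  assumes \<sigma>: "\<sigma> \<in> bilinear_forms"
  shows "casimir_op \<sigma> \<in> bilinear_forms"
  unfolding casimir_op_def[abs_def] by (intro bilinear_sum_closed bilinear_compose[OF \<sigma>] lin_intros)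

lemma casimir_op_combine:
  "casimir_op (\<lambda>x y. s * \<sigma> x y + t * \<tau> x y) = (\<lambda>x y. s * casimir_op \<sigma> x y + t * casimir_op \<tau> x y)"
  by (simp add: casimir_op_def[abs_def] sum.distrib sum_distrib_left)

lemma casimir_op_symmetric: "\<sigma> \<in> symmetric_forms \<Longrightarrow> casimir_op \<sigma> \<in> symmetric_forms"
proof -
  assume "\<sigma> \<in> symmetric_forms"
  then have \<sigma>: "\<sigma> \<in> bilinear_forms" and sym: "\<And>x y. \<sigma> x y = \<sigma> y x"
    unfolding symmetric_forms_def by auto
  have "casimir_op \<sigma> x y = casimir_op \<sigma> y x" for x y
  proof -
    have "casimir_op \<sigma> x y = (\<Sum>b\<in>basis. \<sigma> (bracket (dual b) x) (bracket b y))"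
      unfolding casimir_op_def
      by (rule casimir_swap[of "\<lambda>p q. \<sigma> (bracket p x) (bracket q y)"])
        (intro bilinear_compose[OF \<sigma>] lin_intros)
    then show ?thesis unfolding casimir_op_def using sym by simp
  qed
  then show ?thesis using casimir_op_bilinear[OF \<sigma>] unfolding symmetric_forms_def by blast
qed

text \<open>The trace is the contraction of \<open>\<beta>(dual b, [x, [y, \<Sigma> b]]) = \<sigma>(b, [y, [x, dual b]])\<close>, and
  invariance of the Casimir tensor moves one bracket to the other slot.\<close>

lemma Omega_eq_casimir_op:
  assumes "\<sigma> \<in> symmetric_forms"
  shows "Omega \<sigma> = (\<lambda>x y. - 2 * casimir_op \<sigma> x y)"
proof -
  have \<sigma>: "\<sigma> \<in> bilinear_forms" and sym: "\<sigma> x y = \<sigma> y x" for x y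
    using assms unfolding symmetric_forms_def by auto
  let ?P = "\<lambda>S. lin S \<and> (\<forall>x y. \<sigma> x y = killing (S x) y)"
  have "\<exists>x'. killing x' = \<sigma> x" for x
    by (rule ex1_implies_ex[OF killing_represents[OF bilinear_right[OF \<sigma>]]])
  then obtain S0 where S0: "\<And>x. killing (S0 x) = \<sigma> x" by metis
  have "lin S0"
    by (intro linI killing_eqI)
      (simp_all add: S0 killing_add_left killing_scale_left bilinear_add_left[OF \<sigma>] bilinear_scale_left[OF \<sigma>])
  then have P: "?P S0" using S0 by simp
  have "(THE S. ?P S) = S0"
  proof (rule the_equality[where P = ?P, OF P])
    fix S assume "?P S"
    then show "S = S0" by (intro ext killing_eqI) (simp add: S0)
  qed
  then have Omega: "Omega \<sigma> = (\<lambda>x y. 2 * trace (Ad x \<circ> Ad y \<circ> S0))"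
    using assms by (simp add: Omega_def Let_def)
  have "trace (Ad x \<circ> Ad y \<circ> S0) = - casimir_op \<sigma> x y" for x y
  proof -
    have "killing (dual b) (bracket x (bracket y (S0 b))) = \<sigma> b (bracket y (bracket x (dual b)))" for b
    proof -
      have "killing (dual b) (bracket x (bracket y (S0 b))) = killing (bracket (bracket (dual b) x) y) (S0 b)"
        by (simp only: killing_invariant)
      also have "bracket (bracket (dual b) x) y = bracket y (bracket x (dual b))"
        using bracket_swap[of "bracket (dual b) x" y] bracket_swap[of "dual b" x]
        by (simp add: bracket_minus_right)
      finally show ?thesis by (simp only: killing_commute[of _ "S0 b"] S0)
    qed
    moreover have "bracket y (bracket x (dual b)) = - bracket (bracket x (dual b)) y" for b
      by (rule bracket_swap)
    ultimately have "trace (Ad x \<circ> Ad y \<circ> S0) = - (\<Sum>b\<in>basis. \<sigma> b (bracket (bracket x (dual b)) y))"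
      by (simp add: trace_contraction bilinear_minus_right[OF \<sigma>] sum_negf)
    also have "\<dots> = (\<Sum>b\<in>basis. \<sigma> (bracket x b) (bracket (dual b) y))"
      by (rule casimir_invariant[of "\<lambda>p q. \<sigma> p (bracket q y)", symmetric])
        (intro bilinear_compose[OF \<sigma>] lin_intros)
    also have "\<dots> = (\<Sum>b\<in>basis. \<sigma> (- bracket b x) (bracket (dual b) y))"
      by (intro sum.cong refl arg_cong2[where f = \<sigma>] bracket_swap)
    also have "\<dots> = - casimir_op \<sigma> x y"
      by (simp add: casimir_op_def bilinear_minus_left[OF \<sigma>] sum_negf)
    finally show ?thesis .
  qed
  then show ?thesis unfolding Omega by simp
qed

section \<open>The operator \<open>\<Pi>\<close>\<close>

text \<open>The operator \<open>\<Pi>\<close> raises all four indices of \<open>\<phi>\<close> and takes brackets of the results.  By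
  invariance \<open>\<beta>([dual a, dual b], u) = \<beta>(dual b, [u, dual a])\<close>, which makes two of the four
  sums over the basis collapse.\<close>

definition pi_form :: "('g \<Rightarrow> 'g \<Rightarrow> 'g \<Rightarrow> 'g \<Rightarrow> 'f) \<Rightarrow> 'g \<Rightarrow> 'g \<Rightarrow> 'f" where
  "pi_form \<phi> u v = (\<Sum>a\<in>basis. \<Sum>c\<in>basis. \<phi> a (bracket u (dual a)) c (bracket v (dual c)))"

lemma pi_form_bilinear:
  assumes \<phi>: "\<phi> \<in> quadrilinear_forms"
  shows "pi_form \<phi> \<in> bilinear_forms"
proof -
  have slots: "(\<lambda>p q. \<phi> a p c q) \<in> bilinear_forms" for a c
    using quadrilinear_slots[OF \<phi>] unfolding bilinear_forms_def by blast
  show ?thesis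
    unfolding pi_form_def[abs_def]
    by (intro bilinear_sum_closed bilinear_compose[OF slots] lin_intros)
qed

lemma pi_form_combine:
  "pi_form (\<lambda>a b c d. s * \<phi> a b c d + t * \<psi> a b c d) = (\<lambda>u v. s * pi_form \<phi> u v + t * pi_form \<psi> u v)"
  by (simp add: pi_form_def[abs_def] sum.distrib sum_distrib_left)

lemma pi_form_tensor4:
  "pi_form (tensor4 (killing x) (killing x') (killing y) (killing y'))
     = tensor2 (killing (bracket x x')) (killing (bracket y y'))"
proof (intro ext)
  fix u v
  have single: "(\<Sum>a\<in>basis. killing x a * killing x' (bracket u (dual a))) = killing (bracket x x') u"
    for x x' u
  proof -
    have "(\<Sum>a\<in>basis. killing x a * killing x' (bracket u (dual a))) = killing x' (bracket u x)"
      by (rule contract(2)) (intro dual_compose[OF killing_dual] lin_intros)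
    also have "\<dots> = killing (bracket x x') u"
      by (simp only: killing_invariant[symmetric] killing_commute[of "bracket x' u" x])
    finally show ?thesis .
  qed
  have "pi_form (tensor4 (killing x) (killing x') (killing y) (killing y')) u v
      = (\<Sum>a\<in>basis. killing x a * killing x' (bracket u (dual a)))
        * (\<Sum>c\<in>basis. killing y c * killing y' (bracket v (dual c)))"
    by (simp add: pi_form_def tensor4_def sum_product mult.assoc)
  then show "pi_form (tensor4 (killing x) (killing x') (killing y) (killing y')) u v
      = tensor2 (killing (bracket x x')) (killing (bracket y y')) u v"
    by (simp add: single tensor2_def)
qed

lemma quadrilinear_expansion:
  assumes \<phi>: "\<phi> \<in> quadrilinear_forms"
  shows "\<phi> = (\<lambda>a b c d. \<Sum>(p, q, r, s)\<in>basis \<times> basis \<times> basis \<times> basis.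
    \<phi> p q r s * tensor4 (killing (dual p)) (killing (dual q)) (killing (dual r)) (killing (dual s)) a b c d)"
proof (intro ext)
  fix a b c d
  note e = contract(1)[OF quadrilinear_slots(1)[OF \<phi>]] contract(1)[OF quadrilinear_slots(2)[OF \<phi>]]
    contract(1)[OF quadrilinear_slots(3)[OF \<phi>]] contract(1)[OF quadrilinear_slots(4)[OF \<phi>]]
  have "\<phi> a b c d = (\<Sum>p\<in>basis. killing (dual p) a * (\<Sum>q\<in>basis. killing (dual q) b *
      (\<Sum>r\<in>basis. killing (dual r) c * (\<Sum>s\<in>basis. killing (dual s) d * \<phi> p q r s))))"
    unfolding e ..
  then show "\<phi> a b c d = (\<Sum>(p, q, r, s)\<in>basis \<times> basis \<times> basis \<times> basis.
    \<phi> p q r s * tensor4 (killing (dual p)) (killing (dual q)) (killing (dual r)) (killing (dual s)) a b c d)"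
    by (simp add: sum.cartesian_product[symmetric] sum_distrib_left tensor4_def mult_ac)
qed

text \<open>Every quadrilinear form is a finite combination of tensor products of linear forms.\<close>

lemma quadrilinear_operator_eqI:
  assumes P: "\<And>\<phi> \<psi> s t. \<phi> \<in> quadrilinear_forms \<Longrightarrow> \<psi> \<in> quadrilinear_forms \<Longrightarrow>
      P (\<lambda>a b c d. s * \<phi> a b c d + t * \<psi> a b c d) = (\<lambda>u v. s * P \<phi> u v + t * P \<psi> u v)"
    and Q: "\<And>\<phi> \<psi> s t. \<phi> \<in> quadrilinear_forms \<Longrightarrow> \<psi> \<in> quadrilinear_forms \<Longrightarrow>
      Q (\<lambda>a b c d. s * \<phi> a b c d + t * \<psi> a b c d) = (\<lambda>u v. s * Q \<phi> u v + t * Q \<psi> u v)"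
    and eq: "\<And>x x' y y'. P (tensor4 (killing x) (killing x') (killing y) (killing y'))
      = Q (tensor4 (killing x) (killing x') (killing y) (killing y'))"
    and \<phi>: "\<phi> \<in> quadrilinear_forms"
  shows "P \<phi> = (Q \<phi> :: 'g \<Rightarrow> 'g \<Rightarrow> 'f)"
proof -
  let ?t = "\<lambda>(p, q, r, s). tensor4 (killing (dual p)) (killing (dual q)) (killing (dual r)) (killing (dual s))"
  let ?k = "\<lambda>(p, q, r, s). \<phi> p q r s"
  have t: "?t i \<in> quadrilinear_forms" for i
    by (cases i) (simp add: quadrilinear_tensor4 killing_dual)
  have "P (\<lambda>a b c d. \<Sum>i\<in>A. ?k i * ?t i a b c d) = Q (\<lambda>a b c d. \<Sum>i\<in>A. ?k i * ?t i a b c d)"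
    if "finite A" for A
    using that
  proof (induction A rule: finite_induct)
    case empty
    show ?case using P[OF \<phi> \<phi>, of 0 0] Q[OF \<phi> \<phi>, of 0 0] by simp
  next
    case (insert i A)
    define \<psi> where "\<psi> = (\<lambda>a b c d. \<Sum>i\<in>A. ?k i * ?t i a b c d)"
    have "(\<lambda>a b c d. ?k i * ?t i a b c d + 0 * ?t i a b c d) \<in> quadrilinear_forms" for i
      by (rule quadrilinear_combine[OF t t])
    then have \<psi>: "\<psi> \<in> quadrilinear_forms"
      unfolding \<psi>_def by (intro quadrilinear_sum_closed) simp
    have "(\<lambda>a b c d. \<Sum>i\<in>insert i A. ?k i * ?t i a b c d) = (\<lambda>a b c d. ?k i * ?t i a b c d + 1 * \<psi> a b c d)"
      using insert by (simp add: \<psi>_def)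
    moreover have "P (?t i) = Q (?t i)" by (cases i) (simp add: eq)
    ultimately show ?case
      using insert.IH P[OF t \<psi>, of "?k i" i 1] Q[OF t \<psi>, of "?k i" i 1] by (simp add: \<psi>_def)
  qed
  from this[of "basis \<times> basis \<times> basis \<times> basis"] show ?thesis
    using quadrilinear_expansion[OF \<phi>] finite_Basis by (simp add: case_prod_unfold)
qed

lemma Pi_op_eq_pi_form:
  assumes "\<phi> \<in> quadrilinear_forms"
  shows "Pi_op \<phi> = pi_form \<phi>"
proof -
  have "Pi_op = restrict pi_form quadrilinear_forms"
    unfolding Pi_op_def
  proof (rule the_equality, goal_cases)
    case 1
    then show ?case
      using pi_form_bilinear quadrilinear_combine quadrilinear_tensor4[OF killing_dual killing_dual killing_dual killing_dual]
      by (auto simp: pi_form_combine pi_form_tensor4)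
  next
    case (2 P)
    show ?case
    proof
      fix \<phi>
      show "P \<phi> = restrict pi_form quadrilinear_forms \<phi>"
      proof (cases "\<phi> \<in> quadrilinear_forms")
        case True
        have on_tensors: "P (tensor4 (killing x) (killing x') (killing y) (killing y'))
            = tensor2 (killing (bracket x x')) (killing (bracket y y'))" for x x' y y'
          using 2 killing_dual by blast
        have combine: "P (\<lambda>a b c d. s * \<phi> a b c d + t * \<psi> a b c d) = (\<lambda>u v. s * P \<phi> u v + t * P \<psi> u v)"
          if "\<phi> \<in> quadrilinear_forms" "\<psi> \<in> quadrilinear_forms" for \<phi> \<psi> s t
          using 2 that by blast
        have "P \<phi> = pi_form \<phi>"
          by (rule quadrilinear_operator_eqI[OF combine pi_form_combine _ True])
            (assumption | rule on_tensors[folded pi_form_tensor4])+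
        with True show ?thesis by simp
      next
        case False
        then show ?thesis using 2 by (auto simp: PiE_def extensional_def)
      qed
    qed
  qed
  then show ?thesis using assms by simp
qed

section \<open>The contraction of \<open>\<Lambda>\<sigma>\<close>\<close>

text \<open>The Casimir tensor is invariant under \<open>u\<close>, so that \<open>u\<close> can be moved from one factor
  of the contracted pair to the other.\<close>

lemma mixed_terms_agree:
  assumes \<sigma>: "\<sigma> \<in> bilinear_forms"
  shows "(\<Sum>a\<in>basis. \<sigma> (bracket c a) (bracket (bracket u (dual a)) w))
    = (\<Sum>a\<in>basis. \<sigma> (bracket (bracket u (dual a)) c) (bracket a w))"
proof -
  have "(\<Sum>a\<in>basis. \<sigma> (bracket c a) (bracket (bracket u (dual a)) w))
      = - (\<Sum>a\<in>basis. \<sigma> (bracket c (bracket u a)) (bracket (dual a) w))"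
    by (subst casimir_invariant[of "\<lambda>p q. \<sigma> (bracket c p) (bracket q w)" u])
      (auto intro!: bilinear_compose[OF \<sigma>] lin_intros)
  also have "\<dots> = (\<Sum>a\<in>basis. \<sigma> (bracket (bracket u a) c) (bracket (dual a) w))"
    by (simp add: bracket_swap[of "bracket u _" c] bilinear_minus_left[OF \<sigma>] sum_negf)
  also have "\<dots> = (\<Sum>a\<in>basis. \<sigma> (bracket (bracket u (dual a)) c) (bracket a w))"
    by (rule casimir_swap[of "\<lambda>p q. \<sigma> (bracket (bracket u p) c) (bracket q w)"])
      (intro bilinear_compose[OF \<sigma>] lin_intros)
  finally show ?thesis .
qed

text \<open>The second argument changes sign under exchange of the two contracted pairs.  In the first
  argument the difference of both orders is \<open>[[c, dual a], u]\<close> by the Jacobi identity, and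
  \<open>casimir_adjoint\<close> then removes one of the two contractions.\<close>

lemma twice_commutator_term:
  assumes \<sigma>: "\<sigma> \<in> bilinear_forms"
  shows "2 * (\<Sum>a\<in>basis. \<Sum>c\<in>basis. \<sigma> (bracket c (bracket (dual a) u)) (bracket (bracket a (dual c)) v))
    = casimir_op \<sigma> u v"
proof -
  let ?h = "\<lambda>p q. \<sigma> (bracket p u) (bracket q v)"
  have h: "?h \<in> bilinear_forms" by (intro bilinear_compose[OF \<sigma>] lin_intros)
  define Q where "Q = (\<Sum>a\<in>basis. \<Sum>c\<in>basis. \<sigma> (bracket c (bracket (dual a) u)) (bracket (bracket a (dual c)) v))"
  have swap_c: "(\<Sum>c\<in>basis. \<sigma> (bracket c (bracket (dual a) u)) (bracket (bracket a (dual c)) v))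
      = (\<Sum>c\<in>basis. \<sigma> (bracket (dual c) (bracket (dual a) u)) (bracket (bracket a c) v))" for a
    by (rule casimir_swap[of "\<lambda>p q. \<sigma> (bracket p (bracket (dual a) u)) (bracket (bracket a q) v)"])
      (intro bilinear_compose[OF \<sigma>] lin_intros)
  have swap_a: "(\<Sum>a\<in>basis. \<sigma> (bracket (dual c) (bracket (dual a) u)) (bracket (bracket a c) v))
      = (\<Sum>a\<in>basis. \<sigma> (bracket (dual c) (bracket a u)) (bracket (bracket (dual a) c) v))" for c
    by (rule casimir_swap[of "\<lambda>p q. \<sigma> (bracket (dual c) (bracket p u)) (bracket (bracket q c) v)", symmetric])
      (intro bilinear_compose[OF \<sigma>] lin_intros)
  have "Q = (\<Sum>c\<in>basis. \<Sum>a\<in>basis. \<sigma> (bracket (dual c) (bracket a u)) (bracket (bracket (dual a) c) v))"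
    unfolding Q_def swap_c by (subst sum.swap) (simp only: swap_a)
  also have "\<dots> = (\<Sum>c\<in>basis. \<Sum>a\<in>basis. - \<sigma> (bracket (dual c) (bracket a u)) (bracket (bracket c (dual a)) v))"
  proof (intro sum.cong refl)
    fix a c
    show "\<sigma> (bracket (dual c) (bracket a u)) (bracket (bracket (dual a) c) v)
        = - \<sigma> (bracket (dual c) (bracket a u)) (bracket (bracket c (dual a)) v)"
      unfolding bracket_swap[of "dual a" c] bracket_minus_left bilinear_minus_right[OF \<sigma>] ..
  qed
  finally have Q': "Q = (\<Sum>a\<in>basis. \<Sum>c\<in>basis. - \<sigma> (bracket (dual a) (bracket c u)) (bracket (bracket a (dual c)) v))" .
  have "?h (bracket c (dual a)) w = \<sigma> (bracket c (bracket (dual a) u)) (bracket w v)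
      + - \<sigma> (bracket (dual a) (bracket c u)) (bracket w v)" for a c w
    unfolding Ad_bracket[of c "dual a" u] diff_conv_add_uminus bilinear_add_left[OF \<sigma>]
      bilinear_minus_left[OF \<sigma>] ..
  then have "Q + Q = (\<Sum>a\<in>basis. \<Sum>c\<in>basis. ?h (bracket c (dual a)) (bracket a (dual c)))"
    by (subst (2) Q', unfold Q_def) (simp only: sum.distrib)
  also have "\<dots> = (\<Sum>c\<in>basis. \<Sum>a\<in>basis. ?h (bracket c (dual a)) (bracket a (dual c)))"
    by (rule sum.swap)
  also have "\<dots> = (\<Sum>c\<in>basis. \<Sum>a\<in>basis. - ?h a (bracket (bracket c (dual a)) (dual c)))"
  proof (rule sum.cong[OF refl])
    fix c
    have f: "(\<lambda>p q. ?h p (bracket q (dual c))) \<in> bilinear_forms"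
      by (intro bilinear_compose[OF \<sigma>] lin_intros)
    have g: "(\<lambda>p q. ?h (bracket c p) (bracket q (dual c))) \<in> bilinear_forms"
      by (intro bilinear_compose[OF \<sigma>] lin_intros)
    show "(\<Sum>a\<in>basis. ?h (bracket c (dual a)) (bracket a (dual c)))
        = (\<Sum>a\<in>basis. - ?h a (bracket (bracket c (dual a)) (dual c)))"
      unfolding casimir_swap[OF g, symmetric] casimir_invariant[OF f] sum_negf ..
  qed
  also have "\<dots> = (\<Sum>a\<in>basis. \<Sum>c\<in>basis. - ?h a (bracket (bracket c (dual a)) (dual c)))"
    by (rule sum.swap)
  also have "\<dots> = (\<Sum>a\<in>basis. ?h a (dual a))"
  proof (rule sum.cong[OF refl])
    fix a
    have "(\<Sum>c\<in>basis. - ?h a (bracket (bracket c (dual a)) (dual c)))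
        = (\<Sum>c\<in>basis. ?h a (bracket (dual c) (bracket c (dual a))))"
    proof (rule sum.cong[OF refl])
      fix c
      show "- ?h a (bracket (bracket c (dual a)) (dual c)) = ?h a (bracket (dual c) (bracket c (dual a)))"
        unfolding bracket_swap[of "dual c" "bracket c (dual a)"] bilinear_minus_right[OF h] ..
    qed
    also have "\<dots> = ?h a (\<Sum>c\<in>basis. bracket (dual c) (bracket c (dual a)))"
      by (rule bilinear_sum_right[OF h, symmetric])
    finally show "(\<Sum>c\<in>basis. - ?h a (bracket (bracket c (dual a)) (dual c))) = ?h a (dual a)"
      unfolding casimir_adjoint .
  qed
  finally show ?thesis by (simp add: Q_def casimir_op_def)
qed

text \<open>The first of the three summands of \<open>\<Lambda>\<sigma>\<close> contracts to \<open>\<sigma>\<close> since the Casimir operator is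
  the identity.  The other two contract to the same form \<open>M\<close>; the Jacobi identity splits \<open>M\<close>
  into the square of \<open>casimir_op\<close> and the form of \<open>twice_commutator_term\<close>.\<close>

theorem pi_form_Lambda:
  assumes "\<sigma> \<in> symmetric_forms"
  shows "pi_form (Lambda \<sigma>) u v = \<sigma> u v - casimir_op \<sigma> u v - 2 * casimir_op (casimir_op \<sigma>) u v"
proof -
  have \<sigma>: "\<sigma> \<in> bilinear_forms"
    using assms unfolding symmetric_forms_def by auto
  define M where "M = (\<Sum>a\<in>basis. \<Sum>c\<in>basis. \<sigma> (bracket (bracket u (dual a)) c) (bracket a (bracket v (dual c))))"
  define Q where "Q = (\<Sum>a\<in>basis. \<Sum>c\<in>basis. \<sigma> (bracket c (bracket (dual a) u)) (bracket (bracket a (dual c)) v))"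
  have "(\<Sum>a\<in>basis. bracket a (bracket w (dual a))) = - w" for w
  proof -
    have "bracket a (bracket w (dual a)) = - bracket a (bracket (dual a) w)" for a
      unfolding bracket_swap[of w "dual a"] bracket_minus_right ..
    then show ?thesis by (simp add: sum_negf casimir_adjoint)
  qed
  then have first: "(\<Sum>a\<in>basis. \<Sum>c\<in>basis. \<sigma> (bracket a (bracket u (dual a))) (bracket c (bracket v (dual c)))) = \<sigma> u v"
    unfolding bilinear_sum_right[OF \<sigma>, symmetric] bilinear_sum_left[OF \<sigma>, symmetric]
    by (simp add: bilinear_minus_left[OF \<sigma>] bilinear_minus_right[OF \<sigma>])
  have third: "(\<Sum>a\<in>basis. \<Sum>c\<in>basis. \<sigma> (bracket c a) (bracket (bracket u (dual a)) (bracket v (dual c)))) = M"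
    unfolding M_def by (subst (1 2) sum.swap) (simp only: mixed_terms_agree[OF \<sigma>])
  have "pi_form (Lambda \<sigma>) u v = \<sigma> u v + M + M"
    using assms by (simp add: pi_form_def Lambda_def sum.distrib first third M_def[symmetric])
  moreover have "M = - casimir_op (casimir_op \<sigma>) u v - Q"
  proof -
    have "\<sigma> (bracket (bracket u (dual a)) c) (bracket a (bracket v (dual c)))
        = - \<sigma> (bracket c (bracket (dual a) u)) (bracket (dual c) (bracket a v))
          - \<sigma> (bracket c (bracket (dual a) u)) (bracket (bracket a (dual c)) v)" for a c
    proof -
      have "bracket (bracket u (dual a)) c = bracket c (bracket (dual a) u)"
        using bracket_swap[of "bracket u (dual a)" c] bracket_swap[of u "dual a"]
        by (simp add: bracket_minus_right)
      moreover have "bracket a (bracket v (dual c))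
          = - (bracket (bracket a (dual c)) v + bracket (dual c) (bracket a v))"
        using Ad_derivation[of a "dual c" v] bracket_swap[of v "dual c"]
        by (simp add: bracket_minus_right)
      ultimately show ?thesis
        by (simp add: bilinear_minus_right[OF \<sigma>] bilinear_add_right[OF \<sigma>] del: minus_add_distrib)
    qed
    then have "M = - (\<Sum>a\<in>basis. \<Sum>c\<in>basis. \<sigma> (bracket c (bracket (dual a) u)) (bracket (dual c) (bracket a v))) - Q"
      unfolding M_def Q_def by (simp add: sum_subtractf sum_negf)
    also have "(\<Sum>a\<in>basis. \<Sum>c\<in>basis. \<sigma> (bracket c (bracket (dual a) u)) (bracket (dual c) (bracket a v)))
        = casimir_op (casimir_op \<sigma>) u v"
      unfolding casimir_op_def[of "casimir_op \<sigma>"] casimir_op_def[of \<sigma>, symmetric]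
      by (rule casimir_swap[of "\<lambda>p q. casimir_op \<sigma> (bracket p u) (bracket q v)", symmetric])
        (intro bilinear_compose[OF casimir_op_bilinear[OF \<sigma>]] lin_intros)
    finally show ?thesis .
  qed
  moreover have "2 * Q = casimir_op \<sigma> u v"
    unfolding Q_def by (rule twice_commutator_term[OF \<sigma>])
  ultimately show ?thesis by (simp add: algebra_simps)
qed

theorem twice_Pi_Lambda:
  assumes "\<sigma> \<in> symmetric_forms"
  shows "2 * Pi_Lambda \<sigma> x y = - (plus_Id Omega 1 \<circ> plus_Id Omega (- 2)) \<sigma> x y"
proof -
  let ?\<tau> = "plus_Id Omega (- 2) \<sigma>"
  have \<tau>: "?\<tau> = (\<lambda>x y. - 2 * casimir_op \<sigma> x y + - 2 * \<sigma> x y)"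
    by (simp add: plus_Id_def[abs_def] Omega_eq_casimir_op[OF assms])
  have "?\<tau> \<in> symmetric_forms"
    using assms casimir_op_symmetric[OF assms] bilinear_combine[of "casimir_op \<sigma>" \<sigma> "- 2" "- 2"]
    unfolding \<tau> by (auto simp: symmetric_forms_def)
  then have "plus_Id Omega 1 ?\<tau> x y = - 2 * casimir_op ?\<tau> x y + ?\<tau> x y"
    by (simp add: plus_Id_def[of _ 1] Omega_eq_casimir_op)
  also have "\<dots> = 4 * casimir_op (casimir_op \<sigma>) x y + 2 * casimir_op \<sigma> x y - 2 * \<sigma> x y"
    unfolding \<tau> casimir_op_combine by (simp add: algebra_simps)
  finally have "- (plus_Id Omega 1 \<circ> plus_Id Omega (- 2)) \<sigma> x y = 2 * pi_form (Lambda \<sigma>) x y"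
    unfolding pi_form_Lambda[OF assms] by (simp add: algebra_simps)
  moreover have "Pi_Lambda \<sigma> = pi_form (Lambda \<sigma>)"
    using Lambda_exterior[OF assms] assms
    by (simp add: Pi_Lambda_def compose_def Pi_op_eq_pi_form exterior_4_forms_def)
  ultimately show ?thesis by simp
qed

end

section \<open>The identity for semisimple Lie algebras\<close>

context semisimple_lie_algebra
begin

lemma nondegenerate_if_Ad_nilpotent:
  assumes "\<And>x v. x \<in> derived killing_radical \<Longrightarrow> \<exists>m. (Ad x ^^ m) v = 0"
  shows "nondegenerate_lie_algebra scale bracket"
proof
  show "x = 0" if "\<And>y. killing x y = 0" for x
    using that killing_radical_zero[OF assms] unfolding killing_radical_def by blast
qed

end

theorem theoremA:
  fixes scl_r :: "real \<Rightarrow> 'g::ab_group_add \<Rightarrow> 'g" and bracket_r :: "'g \<Rightarrow> 'g \<Rightarrow> 'g"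
    and scl_c :: "complex \<Rightarrow> 'h::ab_group_add \<Rightarrow> 'h" and bracket_c :: "'h \<Rightarrow> 'h \<Rightarrow> 'h"
  shows
    "(semisimple_lie_algebra scl_r bracket_r \<longrightarrow>
        (\<forall>\<sigma>\<in>lie_algebra.symmetric_forms scl_r. \<forall>x y.
           2 * lie_algebra.Pi_Lambda scl_r bracket_r \<sigma> x y =
           - (lie_algebra.plus_Id (lie_algebra.Omega scl_r bracket_r) 1 \<circ>
              lie_algebra.plus_Id (lie_algebra.Omega scl_r bracket_r) (- 2)) \<sigma> x y)) \<and>
     (semisimple_lie_algebra scl_c bracket_c \<longrightarrow>
        (\<forall>\<sigma>\<in>lie_algebra.symmetric_forms scl_c. \<forall>x y.
           2 * lie_algebra.Pi_Lambda scl_c bracket_c \<sigma> x y =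
           - (lie_algebra.plus_Id (lie_algebra.Omega scl_c bracket_c) 1 \<circ>
              lie_algebra.plus_Id (lie_algebra.Omega scl_c bracket_c) (- 2)) \<sigma> x y))"
proof (intro conjI impI ballI allI)
  fix \<sigma> x y
  assume semi: "semisimple_lie_algebra scl_r bracket_r" and \<sigma>: "\<sigma> \<in> lie_algebra.symmetric_forms scl_r"
  have "real_lie_algebra scl_r bracket_r"
    by (intro real_lie_algebra.intro semisimple_lie_algebra.axioms(1) semi)
  then have "nondegenerate_lie_algebra scl_r bracket_r"
    by (intro semisimple_lie_algebra.nondegenerate_if_Ad_nilpotent[OF semi] real_lie_algebra.Ad_nilpotent)
  from nondegenerate_lie_algebra.twice_Pi_Lambda[OF this \<sigma>]
  show "2 * lie_algebra.Pi_Lambda scl_r bracket_r \<sigma> x y =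
      - (lie_algebra.plus_Id (lie_algebra.Omega scl_r bracket_r) 1 \<circ>
         lie_algebra.plus_Id (lie_algebra.Omega scl_r bracket_r) (- 2)) \<sigma> x y" .
next
  fix \<sigma> x y
  assume semi: "semisimple_lie_algebra scl_c bracket_c" and \<sigma>: "\<sigma> \<in> lie_algebra.symmetric_forms scl_c"
  have "complex_lie_algebra scl_c bracket_c"
    by (intro complex_lie_algebra.intro semisimple_lie_algebra.axioms(1) semi)
  then have "nondegenerate_lie_algebra scl_c bracket_c"
    by (intro semisimple_lie_algebra.nondegenerate_if_Ad_nilpotent[OF semi] complex_lie_algebra.Ad_nilpotent)
  from nondegenerate_lie_algebra.twice_Pi_Lambda[OF this \<sigma>]
  show "2 * lie_algebra.Pi_Lambda scl_c bracket_c \<sigma> x y =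
      - (lie_algebra.plus_Id (lie_algebra.Omega scl_c bracket_c) 1 \<circ>
         lie_algebra.plus_Id (lie_algebra.Omega scl_c bracket_c) (- 2)) \<sigma> x y" .
qed

end
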